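(* Let $\alpha\ge2$ and $K>0$. For any $\varepsilon\in(0,1)$ there exist $C_1,C_2>0$ depending only on $\alpha$, $K$ and $\varepsilon$ such that, for all integers $n\ge2$, $p\ge1$ and $s\in[p]$, the test $$\phi_{\mathcal{P},\mathrm{dense}}:=\mathbf{1}\Bigl\{\max_{t\in\mathcal{T}}A_t^{\mathrm{MoM}}/r_t>1\Bigr\}$$ with $$r_t=C_1p^{(1/2)\vee(2/\alpha)}G_t,\qquad G_t=t\wedge\Delta,\qquad\Delta=2^{3+\lceil\log_2\log\log(8n)\rceil}$$ satisfies $\mathcal{R}_{\mathcal{P}}(\rho,\phi_{\mathcal{P},\mathrm{dense}})\le\varepsilon$ as long as $$\rho^2\ge C_2\,p^{(2/\alpha)\vee(1/2)}\log\log(8n).$$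
   Context: Notation: $[m]=\{1,\dots,m\}$; $x\wedge y=\min(x,y)$, $x\vee y=\max(x,y)$; $\log$ is the natural logarithm; $\|v\|_0$ is the number of nonzero entries of $v$; the median of finitely many reals is the usual one (average of the two middle order statistics when their number is even). Model: $X=\theta+E\in\mathbb{R}^{p\times n}$, with deterministic $\theta$ and random $E\sim P_e$; $X_t,\theta_t,E_t\in\mathbb{R}^p$ denote the $t$-th columns and $X_t(j)$ the $j$-th entry of $X_t$. $\mathbb{E}_{\theta,P_e}$ is expectation under the law of $X$. Null space: $\Theta_0(p,n)=\{\theta:\exists\mu\in\mathbb{R}^p,\ \theta_t=\mu\ \forall t\in[n]\}$. For $t_0\in[n-1]$, $\Theta^{(t_0)}(p,n,s,\rho)$ is the set of $\theta$ for which there are $\mu_1,\mu_2\in\mathbb{R}^p$ with $\theta_t=\mu_1$ for $t\le t_0$, $\theta_t=\mu_2$ for $t>t_0$, $\|\mu_1-\mu_2\|_0\le s$ and $\frac{t_0(n-t_0)}{n}\|\mu_1-\mu_2\|_2^2\ge\rho^2$. Alternative space: $\Theta(p,n,s,\rho)=\bigcup_{t_0=1}^{n-1}\Theta^{(t_0)}(p,n,s,\rho)$. Noise class: $\mathcal{P}_{\alpha,K}$ is the class of distributions of real random variables $W$ with $\mathbb{E}W=0$, $\mathbb{E}W^2=1$, $\mathbb{E}|W/K|^\alpha\le1$. $\mathcal{P}_{\alpha,K}^{\otimes}$ is the class of joint distributions of $E$ with mutually independent entries, each entry having a (possibly different) distribution in $\mathcal{P}_{\alpha,K}$. Worst-case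 testing error of a measurable test $\phi:\mathbb{R}^{p\times n}\to\{0,1\}$: $$\mathcal{R}_{\mathcal{P}}(\rho,\phi)=\sup_{P_e\in\mathcal{P}_{\alpha,K}^{\otimes}}\sup_{\theta\in\Theta_0(p,n)}\mathbb{E}_{\theta,P_e}(\phi)+\sup_{P_e\in\mathcal{P}_{\alpha,K}^{\otimes}}\sup_{\theta\in\Theta(p,n,s,\rho)}\mathbb{E}_{\theta,P_e}(1-\phi).$$ Test statistics: $\mathcal{T}=\{1,2,4,\dots,2^{\lfloor\log_2(n/2)\rfloor}\}$ and $Z_i=(X_i-X_{n-i+1})/\sqrt2$ for $i\le n/2$. For $t\in\mathcal{T}$, $\{Z_1,\dots,Z_t\}$ is split (by a fixed, data-independent partition) into $G_t$ groups of equal size $t/G_t$; $\overline Z_{t,g}\in\mathbb{R}^p$ is the sample mean of the $g$-th group, $V_{t,g}(j)=\overline Z_{t,g}^2(j)-G_t/t$ for $g\in[G_t]$, $j\in[p]$, and $$A_t^{\mathrm{MoM}}=t\cdot\mathrm{median}\Bigl(\sum_{j=1}^pV_{t,1}(j),\dots,\sum_{j=1}^pV_{t,G_t}(j)\Bigr).$$ *)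

theory Defs
  imports "HOL-Probability.Probability"
begin

section \<open>Matrices and the mean change-point model\<close>

text \<open>
  A matrix in \<open>\<real>\<^sup>p\<^sup>\<times>\<^sup>n\<close> is a function of pairs \<open>(j, t)\<close> with row (coordinate) \<open>j \<in> {1..p}\<close> and
  column (time) \<open>t \<in> {1..n}\<close>, extended by \<open>undefined\<close> outside; thus \<open>X\<^sub>t(j)\<close> is \<open>X (j, t)\<close>.
  A vector in \<open>\<real>\<^sup>p\<close> is a function on \<open>nat\<close> of which only the values on \<open>{1..p}\<close> are used.
\<close>

type_synonym mat = "nat \<times> nat \<Rightarrow> real"

definition mat_ix :: "nat \<Rightarrow> nat \<Rightarrow> (nat \<times> nat) set" where
  "mat_ix p n = {1..p} \<times> {1..n}"

definition mat_borel :: "nat \<Rightarrow> nat \<Rightarrow> mat measure" where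
  "mat_borel p n = PiM (mat_ix p n) (\<lambda>_. borel)"

definition l0norm :: "nat \<Rightarrow> (nat \<Rightarrow> real) \<Rightarrow> nat" where
  "l0norm p v = card {j \<in> {1..p}. v j \<noteq> 0}"

definition null_space :: "nat \<Rightarrow> nat \<Rightarrow> mat set" where
  "null_space p n = {\<theta> \<in> mat_ix p n \<rightarrow>\<^sub>E UNIV.
     \<exists>\<mu>. \<forall>t\<in>{1..n}. \<forall>j\<in>{1..p}. \<theta> (j, t) = \<mu> j}"

definition alt_space_at :: "nat \<Rightarrow> nat \<Rightarrow> nat \<Rightarrow> nat \<Rightarrow> real \<Rightarrow> mat set" where
  "alt_space_at t\<^sub>0 p n s \<rho> = {\<theta> \<in> mat_ix p n \<rightarrow>\<^sub>E UNIV.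
     \<exists>\<mu>\<^sub>1 \<mu>\<^sub>2. (\<forall>t\<in>{1..n}. \<forall>j\<in>{1..p}. \<theta> (j, t) = (if t \<le> t\<^sub>0 then \<mu>\<^sub>1 j else \<mu>\<^sub>2 j)) \<and>
       l0norm p (\<lambda>j. \<mu>\<^sub>1 j - \<mu>\<^sub>2 j) \<le> s \<and>
       real t\<^sub>0 * (real n - real t\<^sub>0) / real n * (L2_set (\<lambda>j. \<mu>\<^sub>1 j - \<mu>\<^sub>2 j) {1..p})\<^sup>2 \<ge> \<rho>\<^sup>2}"

definition alt_space :: "nat \<Rightarrow> nat \<Rightarrow> nat \<Rightarrow> real \<Rightarrow> mat set" where
  "alt_space p n s \<rho> = (\<Union>t\<^sub>0\<in>{1..n-1}. alt_space_at t\<^sub>0 p n s \<rho>)"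

definition noise_class :: "real \<Rightarrow> real \<Rightarrow> real measure set" where
  "noise_class \<alpha> K = {D. real_distribution D \<and>
     integrable D (\<lambda>w. w) \<and> (\<integral>w. w \<partial>D) = 0 \<and>
     integrable D (\<lambda>w. w\<^sup>2) \<and> (\<integral>w. w\<^sup>2 \<partial>D) = 1 \<and>
     integrable D (\<lambda>w. \<bar>w / K\<bar> powr \<alpha>) \<and> (\<integral>w. \<bar>w / K\<bar> powr \<alpha> \<partial>D) \<le> 1}"

definition joint_noise_class :: "real \<Rightarrow> real \<Rightarrow> nat \<Rightarrow> nat \<Rightarrow> mat measure set" where
  "joint_noise_class \<alpha> K p n = {P. prob_space P \<and> sets P = sets (mat_borel p n) \<and>
     prob_space.indep_vars P (\<lambda>_. borel) (\<lambda>i E. E i) (mat_ix p n) \<and>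
     (\<forall>i\<in>mat_ix p n. distr P borel (\<lambda>E. E i) \<in> noise_class \<alpha> K)}"

definition law :: "nat \<Rightarrow> nat \<Rightarrow> mat \<Rightarrow> mat measure \<Rightarrow> mat measure" where
  "law p n \<theta> P = distr P (mat_borel p n) (\<lambda>E. \<lambda>i\<in>mat_ix p n. \<theta> i + E i)"

text \<open>
  The risk takes values in \<open>ennreal\<close>, so the suprema always exist and those over an empty
  class (the noise class is empty for \<open>K < 1\<close>) are \<open>0\<close>.
\<close>

definition risk :: "real \<Rightarrow> real \<Rightarrow> nat \<Rightarrow> nat \<Rightarrow> nat \<Rightarrow> real \<Rightarrow> (mat \<Rightarrow> real) \<Rightarrow> ennreal" where
  "risk \<alpha> K p n s \<rho> \<phi> =
     (\<Squnion>P\<in>joint_noise_class \<alpha> K p n. \<Squnion>\<theta>\<in>null_space p n.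
        \<integral>\<^sup>+X. ennreal (\<phi> X) \<partial>law p n \<theta> P) +
     (\<Squnion>P\<in>joint_noise_class \<alpha> K p n. \<Squnion>\<theta>\<in>alt_space p n s \<rho>.
        \<integral>\<^sup>+X. ennreal (1 - \<phi> X) \<partial>law p n \<theta> P)"

section \<open>The median-of-means test\<close>

definition median :: "real list \<Rightarrow> real" where
  "median xs = (let ys = sort xs; m = length xs in
     if odd m then ys ! (m div 2) else (ys ! (m div 2 - 1) + ys ! (m div 2)) / 2)"

definition grid :: "nat \<Rightarrow> nat set" where
  "grid n = {2 ^ k | k :: nat. int k \<le> \<lfloor>log 2 (real n / 2)\<rfloor>}"

text \<open>
  For \<open>n \<ge> 2\<close> the exponent is positive (\<open>ln (ln 16) > 1\<close>), so the conversion to \<open>nat\<close> loses nothing.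
\<close>

definition Delta :: "nat \<Rightarrow> nat" where
  "Delta n = 2 ^ nat (3 + \<lceil>log 2 (ln (ln (8 * real n)))\<rceil>)"

definition num_groups :: "nat \<Rightarrow> nat \<Rightarrow> nat" where
  "num_groups n t = min t (Delta n)"

text \<open>
  \<open>B t g\<close> is the set of indices \<open>i\<close> of the \<open>Z\<^sub>i\<close> that are put into the \<open>g\<close>-th group at scale \<open>t\<close>.
\<close>

definition equal_grouping :: "nat \<Rightarrow> (nat \<Rightarrow> nat \<Rightarrow> nat set) \<Rightarrow> bool" where
  "equal_grouping n B \<longleftrightarrow> (\<forall>t\<in>grid n.
     (\<Union>g\<in>{1..num_groups n t}. B t g) = {1..t} \<and>
     disjoint_family_on (B t) {1..num_groups n t} \<and>
     (\<forall>g\<in>{1..num_groups n t}. real (card (B t g)) = real t / real (num_groups n t)))"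

definition Zdiff :: "nat \<Rightarrow> mat \<Rightarrow> nat \<Rightarrow> nat \<Rightarrow> real" where
  "Zdiff n X i j = (X (j, i) - X (j, n - i + 1)) / sqrt 2"

definition Zbar :: "nat \<Rightarrow> (nat \<Rightarrow> nat \<Rightarrow> nat set) \<Rightarrow> mat \<Rightarrow> nat \<Rightarrow> nat \<Rightarrow> nat \<Rightarrow> real" where
  "Zbar n B X t g j = (\<Sum>i\<in>B t g. Zdiff n X i j) / real (card (B t g))"

definition V :: "nat \<Rightarrow> (nat \<Rightarrow> nat \<Rightarrow> nat set) \<Rightarrow> mat \<Rightarrow> nat \<Rightarrow> nat \<Rightarrow> nat \<Rightarrow> real" where
  "V n B X t g j = (Zbar n B X t g j)\<^sup>2 - real (num_groups n t) / real t"

definition A_MoM :: "nat \<Rightarrow> nat \<Rightarrow> (nat \<Rightarrow> nat \<Rightarrow> nat set) \<Rightarrow> mat \<Rightarrow> nat \<Rightarrow> real" where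
  "A_MoM p n B X t =
     real t * median (map (\<lambda>g. \<Sum>j\<in>{1..p}. V n B X t g j) [1..<num_groups n t + 1])"

definition threshold :: "real \<Rightarrow> real \<Rightarrow> nat \<Rightarrow> nat \<Rightarrow> nat \<Rightarrow> real" where
  "threshold \<alpha> C\<^sub>1 p n t = C\<^sub>1 * real p powr (max (1/2) (2/\<alpha>)) * real (num_groups n t)"

definition dense_test ::
  "real \<Rightarrow> real \<Rightarrow> nat \<Rightarrow> nat \<Rightarrow> (nat \<Rightarrow> nat \<Rightarrow> nat set) \<Rightarrow> mat \<Rightarrow> real" where
  "dense_test \<alpha> C\<^sub>1 p n B X =
     of_bool ((MAX t\<in>grid n. A_MoM p n B X t / threshold \<alpha> C\<^sub>1 p n t) > 1)"

subsection \<open>Measurability of the test\<close>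

text \<open>
  The risk of a test is an expectation only if the test is measurable; this holds for
  \<^const>\<open>dense_test\<close>.
\<close>

lemma sorted_nth_le_iff:
  fixes ys :: "real list"
  assumes "sorted ys" "k < length ys"
  shows "ys ! k \<le> c \<longleftrightarrow> k < length (filter (\<lambda>x. x \<le> c) ys)"
proof -
  have eq: "filter (\<lambda>x. x \<le> c) ys = takeWhile (\<lambda>x. x \<le> c) ys"
    using assms(1)
  proof (induction ys)
    case (Cons a ys)
    have "filter (\<lambda>x. x \<le> c) ys = []" if "\<not> a \<le> c"
      using Cons.prems that by (force simp: filter_empty_conv)
    then show ?case using Cons by auto
  qed simp
  show ?thesis
  proof
    assume le: "ys ! k \<le> c"
    have "k < length (takeWhile (\<lambda>x. x \<le> c) ys)"
    proof (rule ccontr)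
      assume neg: "\<not> k < length (takeWhile (\<lambda>x. x \<le> c) ys)"
      let ?m = "length (takeWhile (\<lambda>x. x \<le> c) ys)"
      have "?m < length ys" using neg assms(2) by linarith
      then have "\<not> ys ! ?m \<le> c" by (rule nth_length_takeWhile)
      moreover have "ys ! ?m \<le> ys ! k"
        using assms neg by (intro sorted_nth_mono) auto
      ultimately show False using le by linarith
    qed
    then show "k < length (filter (\<lambda>x. x \<le> c) ys)" by (simp add: eq)
  next
    assume "k < length (filter (\<lambda>x. x \<le> c) ys)"
    then have k: "k < length (takeWhile (\<lambda>x. x \<le> c) ys)" by (simp add: eq)
    then have "takeWhile (\<lambda>x. x \<le> c) ys ! k \<in> set (takeWhile (\<lambda>x. x \<le> c) ys)"
      by (rule nth_mem)
    then have "takeWhile (\<lambda>x. x \<le> c) ys ! k \<le> c" by (blast dest: set_takeWhileD)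
    then show "ys ! k \<le> c" using k by (simp add: takeWhile_nth)
  qed
qed

lemma borel_measurable_sort_nth:
  fixes f :: "'i \<Rightarrow> 'a \<Rightarrow> real"
  assumes "\<And>g. g \<in> set gs \<Longrightarrow> f g \<in> borel_measurable M" and "k < length gs"
  shows "(\<lambda>x. sort (map (\<lambda>g. f g x) gs) ! k) \<in> borel_measurable M"
proof (rule borel_measurableI_le)
  fix c
  have count: "(\<lambda>x. \<Sum>g\<leftarrow>gs. indicator {..c} (f g x) :: real) \<in> borel_measurable M"
    using assms(1)
  proof (induction gs)
    case (Cons g gs)
    have [measurable]: "f g \<in> borel_measurable M" using Cons.prems by simp
    have [measurable]: "(\<lambda>x. \<Sum>g\<leftarrow>gs. indicator {..c} (f g x) :: real) \<in> borel_measurable M"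
      using Cons by simp
    show ?case by simp
  qed simp
  have len: "real (length (filter (\<lambda>y. y \<le> c) (sort (map (\<lambda>g. f g x) gs))))
      = (\<Sum>g\<leftarrow>gs. indicator {..c} (f g x))" for x
  proof -
    have "real (length (filter (\<lambda>y. y \<le> c) (map (\<lambda>g. f g x) gs)))
      = (\<Sum>g\<leftarrow>gs. indicator {..c} (f g x))"
      by (induction gs) (auto simp: indicator_def)
    moreover have "length (filter (\<lambda>y. y \<le> c) (sort xs)) = length (filter (\<lambda>y. y \<le> c) xs)"
      for xs by (metis filter_sort length_sort)
    ultimately show ?thesis by metis
  qed
  have "{x \<in> space M. sort (map (\<lambda>g. f g x) gs) ! k \<le> c}
      = {x \<in> space M. real k < (\<Sum>g\<leftarrow>gs. indicator {..c} (f g x))}"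
    unfolding len[symmetric] using assms(2) by (auto simp: sorted_nth_le_iff)
  also have "\<dots> \<in> sets M" using count by measurable
  finally show "{x \<in> space M. sort (map (\<lambda>g. f g x) gs) ! k \<le> c} \<in> sets M" .
qed

lemma borel_measurable_median:
  fixes f :: "'i \<Rightarrow> 'a \<Rightarrow> real"
  assumes "\<And>g. g \<in> set gs \<Longrightarrow> f g \<in> borel_measurable M" and "gs \<noteq> []"
  shows "(\<lambda>x. median (map (\<lambda>g. f g x) gs)) \<in> borel_measurable M"
proof -
  have "length gs > 0" using assms(2) by simp
  then have 1: "length gs div 2 < length gs" "length gs div 2 - 1 < length gs" by linarith+
  note m = borel_measurable_sort_nth[where f = f and gs = gs, OF assms(1)]
  show ?thesis
    using m[OF _ 1(1)] m[OF _ 1(2)]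
    by (cases "odd (length gs)") (simp_all add: median_def Let_def)
qed

lemma finite_grid: "finite (grid n)"
proof -
  have "grid n \<subseteq> (\<lambda>k. 2 ^ k) ` {..nat \<lfloor>log 2 (real n / 2)\<rfloor>}"
    unfolding grid_def by (auto simp: le_nat_iff intro!: imageI)
  then show ?thesis by (rule finite_subset) simp
qed

lemma one_in_grid: "n \<ge> 2 \<Longrightarrow> 1 \<in> grid n"
  unfolding grid_def by (auto intro!: exI[of _ 0])

lemma grid_bounds:
  assumes "t \<in> grid n" "n \<ge> 2"
  shows "1 \<le> t" "2 * t \<le> n"
proof -
  obtain k where t: "t = 2 ^ k" and k: "int k \<le> \<lfloor>log 2 (real n / 2)\<rfloor>"
    using assms(1) by (auto simp: grid_def)
  show "1 \<le> t" by (simp add: t)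
  have "real k \<le> log 2 (real n / 2)" using k by linarith
  then have "2 powr real k \<le> real n / 2" using assms(2) by (simp add: le_log_iff)
  then have "2 * real t \<le> real n" by (simp add: t powr_realpow)
  then show "2 * t \<le> n" by linarith
qed

lemma measurable_dense_test:
  assumes n: "n \<ge> 2" and B: "equal_grouping n B"
  shows "dense_test \<alpha> C\<^sub>1 p n B \<in> borel_measurable (mat_borel p n)"
proof -
  have A [measurable]: "(\<lambda>X. A_MoM p n B X t) \<in> borel_measurable (mat_borel p n)"
    if t: "t \<in> grid n" for t
  proof -
    have Z: "(\<lambda>X. Zdiff n X i j) \<in> borel_measurable (mat_borel p n)"
      if "i \<in> {1..t}" "j \<in> {1..p}" for i j
    proof -
      have "(j, i) \<in> mat_ix p n" "(j, n - i + 1) \<in> mat_ix p n"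
        using that grid_bounds[OF t n] by (auto simp: mat_ix_def)
      then have [measurable]: "(\<lambda>X. X (j, i)) \<in> borel_measurable (mat_borel p n)"
        "(\<lambda>X. X (j, n - i + 1)) \<in> borel_measurable (mat_borel p n)"
        unfolding mat_borel_def by (auto intro: measurable_component_singleton)
      show ?thesis unfolding Zdiff_def by measurable
    qed
    have S: "(\<lambda>X. \<Sum>j\<in>{1..p}. V n B X t g j) \<in> borel_measurable (mat_borel p n)"
      if "g \<in> {1..num_groups n t}" for g
    proof -
      have "(\<Union>g\<in>{1..num_groups n t}. B t g) = {1..t}"
        using B t by (simp add: equal_grouping_def)
      then have "B t g \<subseteq> {1..t}" using that by blast
      then show ?thesis
        unfolding V_def Zbar_def
        by (intro borel_measurable_sum borel_measurable_diff borel_measurable_power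
            borel_measurable_divide borel_measurable_const Z) auto
    qed
    have "num_groups n t \<ge> 1"
      using grid_bounds[OF t n] by (simp add: num_groups_def Delta_def)
    then show ?thesis
      unfolding A_MoM_def
      by (intro borel_measurable_times borel_measurable_const borel_measurable_median S) auto
  qed
  have ne: "grid n \<noteq> {}" using one_in_grid[OF n] by auto
  have "dense_test \<alpha> C\<^sub>1 p n B =
      (\<lambda>X. of_bool (\<exists>t\<in>grid n. A_MoM p n B X t / threshold \<alpha> C\<^sub>1 p n t > 1))"
    unfolding dense_test_def using ne by (auto simp: fun_eq_iff Max_gr_iff finite_grid)
  also have "\<dots> = indicator {X. \<exists>t\<in>grid n. A_MoM p n B X t / threshold \<alpha> C\<^sub>1 p n t > 1}"
    by (auto simp: fun_eq_iff indicator_def)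
  also have "\<dots> \<in> borel_measurable (mat_borel p n)"
  proof (rule borel_measurable_indicator')
    have "{X \<in> space (mat_borel p n).
        \<exists>t\<in>grid n. A_MoM p n B X t / threshold \<alpha> C\<^sub>1 p n t > 1} \<in> sets (mat_borel p n)"
      by (intro sets.sets_Collect_finite_Ex finite_grid) measurable
    then show "{X \<in> space (mat_borel p n).
        X \<in> {X. \<exists>t\<in>grid n. A_MoM p n B X t / threshold \<alpha> C\<^sub>1 p n t > 1}} \<in> sets (mat_borel p n)"
      by simp
  qed
  finally show ?thesis .
qed

end

theory Submission
  imports Defs
begin

text \<open>
  The differences \<open>W\<^sub>i = (E\<^sub>i - E\<^bsub>n-i+1\<^esub>) / \<surd>2\<close> are again independent, centred and of variance one.
  For a group of size \<open>m\<close> put \<open>S = \<Sum>\<^sub>j ((\<Sum>\<^sub>i W\<^sub>i(j))\<^sup>2 / m - 1)\<close>. Expanding the square avoids moment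
  inequalities for sums: the off-diagonal part, divided by \<open>m\<close>, has second moment at most \<open>4 p\<close> and only
  needs the variance of the noise, and the diagonal part is \<open>1/m\<close> times a sum of \<open>p m\<close> independent centred
  variables with bounded moment of order \<open>r = min (\<alpha>/2) 2\<close>, which is controlled by truncation at
  the level \<open>(p m L)\<^bsup>1/r\<^esup>\<close>. Hence \<open>\<bar>S\<bar> \<le> 3 L p\<^bsup>1/r\<^esup>\<close> except with probability \<open>q = O(1/L)\<close>, uniformly
  in \<open>m\<close>, and \<open>1/r = max (1/2) (2/\<alpha>)\<close>.

  If the median of \<open>G\<close> independent statistics is bad, so are at least half of them, and a union
  bound over the possible sets of bad groups gives the probability \<open>(2 \<surd>q)\<^sup>G\<close>. Since
  \<open>\<Delta> \<ge> ln (ln (8 n)) + 1\<close>, these probabilities are summable over the dyadic grid. Under the alternative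
  the largest power of two \<open>t \<le> min t\<^sub>0 (n - t\<^sub>0)\<close> already detects the change: all \<open>Z\<^sub>i\<close> with \<open>i \<le> t\<close>
  have the same mean, and the resulting drift dominates \<open>S\<close> and the cross term.
\<close>

section \<open>Sums of independent variables\<close>

text \<open>The cross terms run over ordered pairs of distinct entries with equal first component,
  the form to which \<open>indep_vars_offdiagonal_square\<close> applies with
  \<open>h = fst\<close>.\<close>

lemma sum_square_offdiagonal:
  fixes w :: "'j \<times> 'i \<Rightarrow> real"
  assumes "finite J" "finite B"
  shows "(\<Sum>j\<in>J. (\<Sum>i\<in>B. w (j, i))\<^sup>2) = (\<Sum>k\<in>J \<times> B. (w k)\<^sup>2) +
    (\<Sum>k\<in>J \<times> B. \<Sum>l | l \<in> J \<times> B \<and> l \<noteq> k \<and> fst l = fst k. w k * w l)"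
proof -
  have row: "(\<Sum>l | l \<in> J \<times> B \<and> l \<noteq> (j, i) \<and> fst l = j. w (j, i) * w l) =
      (\<Sum>i'\<in>B - {i}. w (j, i) * w (j, i'))" if "j \<in> J" for j i
  proof -
    have "{l. l \<in> J \<times> B \<and> l \<noteq> (j, i) \<and> fst l = j} = Pair j ` (B - {i})"
      using that by auto
    then show ?thesis by (simp add: sum.reindex inj_on_def)
  qed
  have "(\<Sum>k\<in>J \<times> B. (w k)\<^sup>2) +
    (\<Sum>k\<in>J \<times> B. \<Sum>l | l \<in> J \<times> B \<and> l \<noteq> k \<and> fst l = fst k. w k * w l) =
    (\<Sum>(j, i)\<in>J \<times> B. (w (j, i))\<^sup>2 + (\<Sum>i'\<in>B - {i}. w (j, i) * w (j, i')))"
    unfolding sum.distrib[symmetric] by (intro sum.cong) (auto simp: row)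
  also have "\<dots> = (\<Sum>j\<in>J. \<Sum>i\<in>B. (w (j, i))\<^sup>2 + (\<Sum>i'\<in>B - {i}. w (j, i) * w (j, i')))"
    by (simp add: sum.cartesian_product)
  also have "\<dots> = (\<Sum>j\<in>J. \<Sum>i\<in>B. \<Sum>i'\<in>B. w (j, i) * w (j, i'))"
    using assms by (intro sum.cong) (auto simp: sum.remove power2_eq_square)
  finally show ?thesis
    by (simp add: power2_eq_square sum_product)
qed

context prob_space
begin

text \<open>The induction step shared by both second-moment computations below: since
  \<open>w (Y' x)\<close> is centred and independent of \<open>Y\<close>, the cross term vanishes
  and the last term factorises. Only the second moment of the new variable enters, so the case
  \<alpha> = 2 is covered.\<close>

lemma indep_var_innovation_square:
  fixes q s w :: "'b \<Rightarrow> real"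
  assumes ind: "indep_var N Y N' Y'"
    and q [measurable]: "q \<in> borel_measurable N" and s [measurable]: "s \<in> borel_measurable N"
    and w [measurable]: "w \<in> borel_measurable N'"
    and q2: "integrable M (\<lambda>x. (q (Y x))\<^sup>2)" and s2: "integrable M (\<lambda>x. (s (Y x))\<^sup>2)"
    and W1: "integrable M (\<lambda>x. w (Y' x))" and W2: "integrable M (\<lambda>x. (w (Y' x))\<^sup>2)" and W0: "expectation (\<lambda>x. w (Y' x)) = 0"
  shows "integrable M (\<lambda>x. (q (Y x) + w (Y' x) * s (Y x))\<^sup>2)"
    and "expectation (\<lambda>x. (q (Y x) + w (Y' x) * s (Y x))\<^sup>2) =
      expectation (\<lambda>x. (q (Y x))\<^sup>2) + expectation (\<lambda>x. (w (Y' x))\<^sup>2) * expectation (\<lambda>x. (s (Y x))\<^sup>2)"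
proof -
  have [measurable]: "Y \<in> M \<rightarrow>\<^sub>M N" "Y' \<in> M \<rightarrow>\<^sub>M N'"
    using ind by (auto simp: indep_var_def indep_vars_def split: bool.splits)
  have qs: "integrable M (\<lambda>x. q (Y x) * s (Y x))"
  proof (rule Bochner_Integration.integrable_bound[OF Bochner_Integration.integrable_add[OF q2 s2]])
    have "\<bar>a * b\<bar> \<le> a\<^sup>2 + b\<^sup>2" for a b :: real
    proof -
      have "2 * (\<bar>a\<bar> * \<bar>b\<bar>) \<le> a\<^sup>2 + b\<^sup>2"
        using sum_squares_bound[of "\<bar>a\<bar>" "\<bar>b\<bar>"] by simp
      moreover have "0 \<le> \<bar>a\<bar> * \<bar>b\<bar>" by simp
      ultimately show ?thesis unfolding abs_mult by linarith
    qed
    then show "AE x in M. norm (q (Y x) * s (Y x)) \<le> norm ((q (Y x))\<^sup>2 + (s (Y x))\<^sup>2)"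
      by simp
  qed measurable
  have "indep_var borel ((\<lambda>y. q y * s y) \<circ> Y) borel (w \<circ> Y')"
    by (rule indep_var_compose[OF ind]) auto
  then have i1: "indep_var borel (\<lambda>x. q (Y x) * s (Y x)) borel (\<lambda>x. w (Y' x))" by (simp add: comp_def)
  have "indep_var borel ((\<lambda>y. (s y)\<^sup>2) \<circ> Y) borel ((\<lambda>y. (w y)\<^sup>2) \<circ> Y')"
    by (rule indep_var_compose[OF ind]) auto
  then have i2: "indep_var borel (\<lambda>x. (s (Y x))\<^sup>2) borel (\<lambda>x. (w (Y' x))\<^sup>2)" by (simp add: comp_def)
  have eq: "(q (Y x) + w (Y' x) * s (Y x))\<^sup>2 =
      (q (Y x))\<^sup>2 + (2 * ((q (Y x) * s (Y x)) * w (Y' x)) + (s (Y x))\<^sup>2 * (w (Y' x))\<^sup>2)" for x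
    by (simp add: power2_eq_square algebra_simps)
  note ints = q2 indep_var_integrable[OF i1 qs W1] indep_var_integrable[OF i2 s2 W2]
  show "integrable M (\<lambda>x. (q (Y x) + w (Y' x) * s (Y x))\<^sup>2)"
    unfolding eq using ints by auto
  have "expectation (\<lambda>x. (q (Y x) + w (Y' x) * s (Y x))\<^sup>2) = expectation (\<lambda>x. (q (Y x))\<^sup>2)
      + (2 * expectation (\<lambda>x. (q (Y x) * s (Y x)) * w (Y' x))
         + expectation (\<lambda>x. (s (Y x))\<^sup>2 * (w (Y' x))\<^sup>2))"
    unfolding eq using ints by simp
  then show "expectation (\<lambda>x. (q (Y x) + w (Y' x) * s (Y x))\<^sup>2) =
      expectation (\<lambda>x. (q (Y x))\<^sup>2) + expectation (\<lambda>x. (w (Y' x))\<^sup>2) * expectation (\<lambda>x. (s (Y x))\<^sup>2)"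
    using indep_var_lebesgue_integral[OF i1 qs W1] indep_var_lebesgue_integral[OF i2 s2 W2] W0
    by (simp add: mult.commute)
qed

lemma indep_vars_sum_square:
  fixes X :: "'i \<Rightarrow> 'a \<Rightarrow> real"
  assumes "finite I" "indep_vars (\<lambda>_. borel) X I"
    and "\<And>i. i \<in> I \<Longrightarrow> integrable M (X i)" "\<And>i. i \<in> I \<Longrightarrow> integrable M (\<lambda>x. (X i x)\<^sup>2)"
    and "\<And>i. i \<in> I \<Longrightarrow> expectation (X i) = 0"
  shows "integrable M (\<lambda>x. (\<Sum>i\<in>I. X i x)\<^sup>2) \<and>
    expectation (\<lambda>x. (\<Sum>i\<in>I. X i x)\<^sup>2) = (\<Sum>i\<in>I. expectation (\<lambda>x. (X i x)\<^sup>2))"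
  using assms
proof (induction I rule: finite_induct)
  case (insert i A)
  have IH: "integrable M (\<lambda>x. (\<Sum>i\<in>A. X i x)\<^sup>2) \<and>
    expectation (\<lambda>x. (\<Sum>i\<in>A. X i x)\<^sup>2) = (\<Sum>i\<in>A. expectation (\<lambda>x. (X i x)\<^sup>2))"
    using insert.prems by (intro insert.IH) (auto intro: indep_vars_subset)
  have ind: "indep_var (PiM A (\<lambda>_. borel)) (\<lambda>\<omega>. \<lambda>i\<in>A. X i \<omega>)
      (PiM {i} (\<lambda>_. borel)) (\<lambda>\<omega>. \<lambda>j\<in>{i}. X j \<omega>)"
    using insert by (intro indep_var_restrict[where I = "insert i A"]) auto
  have w: "(\<lambda>f. f i) \<in> borel_measurable (PiM {i} (\<lambda>_. borel :: real measure))"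
    by (intro measurable_component_singleton) simp
  have q: "(\<lambda>f. \<Sum>i\<in>A. f i) \<in> borel_measurable (PiM A (\<lambda>_. borel :: real measure))"
    by (intro borel_measurable_sum measurable_component_singleton)
  note step = indep_var_innovation_square[where q = "\<lambda>f. \<Sum>i\<in>A. f i" and s = "\<lambda>_. 1" and w = "\<lambda>f. f i",
      OF ind q borel_measurable_const w]
  show ?case
    using step IH insert by (simp add: add.commute prob_space)
qed simp

text \<open>A new index \<open>k\<close> contributes \<open>X k\<close> times twice the sum of the
  earlier variables of its class. This innovation has second moment at most \<open>4 * d\<close>, so
  inserting the indices one by one costs \<open>4 * d\<close> each and never produces a fourth
  moment. In the application the classes are the rows of a group and \<open>d\<close> is the group
  size.\<close>

lemma indep_vars_offdiagonal_square:
  fixes X :: "'i \<Rightarrow> 'a \<Rightarrow> real" and h :: "'i \<Rightarrow> 'h"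
  assumes "finite I" "indep_vars (\<lambda>_. borel) X I"
    and "\<And>i. i \<in> I \<Longrightarrow> integrable M (X i)" "\<And>i. i \<in> I \<Longrightarrow> integrable M (\<lambda>x. (X i x)\<^sup>2)"
    and "\<And>i. i \<in> I \<Longrightarrow> expectation (X i) = 0" "\<And>i. i \<in> I \<Longrightarrow> expectation (\<lambda>x. (X i x)\<^sup>2) = 1"
    and "\<And>i. i \<in> I \<Longrightarrow> card {l\<in>I. h l = h i} \<le> d"
  shows "integrable M (\<lambda>x. (\<Sum>i\<in>I. \<Sum>l | l \<in> I \<and> l \<noteq> i \<and> h l = h i. X i x * X l x)\<^sup>2) \<and>
    expectation (\<lambda>x. (\<Sum>i\<in>I. \<Sum>l | l \<in> I \<and> l \<noteq> i \<and> h l = h i. X i x * X l x)\<^sup>2) \<le> 4 * real d * real (card I)"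
  using assms
proof (induction I rule: finite_induct)
  case (insert k A)
  let ?Q = "\<lambda>f. \<Sum>i\<in>A. \<Sum>l | l \<in> A \<and> l \<noteq> i \<and> h l = h i. f i * f l :: real"
  \<comment> \<open>The pairs \<open>(k, l)\<close> and \<open>(l, k)\<close> both occur in the
    double sum, hence the factor 2.\<close>
  let ?S = "\<lambda>f. 2 * (\<Sum>l | l \<in> A \<and> h l = h k. f l :: real)"
  let ?R = "\<lambda>\<omega>. \<lambda>i\<in>A. X i \<omega>"
  have card_le: "card {l\<in>A. h l = h i} \<le> d" if "i \<in> insert k A" for i
    using card_mono[of "{l\<in>insert k A. h l = h i}" "{l\<in>A. h l = h i}"]
      insert.prems(6)[OF that] insert.hyps(1) by (fastforce intro: order_trans)
  \<comment> \<open>Restricting to the old indices does not change the sum, but displays it as a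
    function of the block \<open>?R\<close>, which is independent of the new variable.\<close>
  have RQ: "?Q (?R x) = (\<Sum>i\<in>A. \<Sum>l | l \<in> A \<and> l \<noteq> i \<and> h l = h i. X i x * X l x)" for x
    by (intro sum.cong) auto
  have RS: "?S (?R x) = 2 * (\<Sum>l | l \<in> A \<and> h l = h k. X l x)" for x
    by simp
  have IH: "integrable M (\<lambda>x. (?Q (?R x))\<^sup>2) \<and> expectation (\<lambda>x. (?Q (?R x))\<^sup>2) \<le> 4 * real d * real (card A)"
    unfolding RQ using insert.prems card_le
    by (intro insert.IH) (auto intro: indep_vars_subset)
  have S: "integrable M (\<lambda>x. (\<Sum>l | l \<in> A \<and> h l = h k. X l x)\<^sup>2) \<and>
    expectation (\<lambda>x. (\<Sum>l | l \<in> A \<and> h l = h k. X l x)\<^sup>2) = (\<Sum>l | l \<in> A \<and> h l = h k. expectation (\<lambda>x. (X l x)\<^sup>2))"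
    using insert.hyps insert.prems
    by (intro indep_vars_sum_square) (auto intro: indep_vars_subset)
  have S1: "integrable M (\<lambda>x. (?S (?R x))\<^sup>2)"
    unfolding RS power_mult_distrib using S by auto
  have S2: "expectation (\<lambda>x. (?S (?R x))\<^sup>2) \<le> 4 * real d"
  proof -
    have "expectation (\<lambda>x. (?S (?R x))\<^sup>2) = 4 * real (card {l \<in> A. h l = h k})"
      unfolding RS power_mult_distrib using S insert.prems(5) by simp
    then show ?thesis using card_le[of k] by simp
  qed
  have ind: "indep_var (PiM A (\<lambda>_. borel)) ?R
      (PiM {k} (\<lambda>_. borel)) (\<lambda>\<omega>. \<lambda>j\<in>{k}. X j \<omega>)"
    using insert by (intro indep_var_restrict[where I = "insert k A"]) auto
  have w: "(\<lambda>f. f k) \<in> borel_measurable (PiM {k} (\<lambda>_. borel :: real measure))"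
    by (intro measurable_component_singleton) simp
  have q: "?Q \<in> borel_measurable (PiM A (\<lambda>_. borel :: real measure))"
    "?S \<in> borel_measurable (PiM A (\<lambda>_. borel :: real measure))"
    by (intro borel_measurable_sum borel_measurable_times borel_measurable_const
        measurable_component_singleton; simp)+
  have eq: "(\<Sum>i\<in>insert k A. \<Sum>l | l \<in> insert k A \<and> l \<noteq> i \<and> h l = h i. X i x * X l x) =
      ?Q (?R x) + X k x * ?S (?R x)" for x
  proof -
    have row: "(\<Sum>l | l \<in> insert k A \<and> l \<noteq> i \<and> h l = h i. X i x * X l x) =
        (\<Sum>l | l \<in> A \<and> l \<noteq> i \<and> h l = h i. X i x * X l x) + (if h k = h i then X i x * X k x else 0)"
      if "i \<in> A" for i
    proof -
      have "{l. l \<in> insert k A \<and> l \<noteq> i \<and> h l = h i} =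
        (if h k = h i then insert k {l. l \<in> A \<and> l \<noteq> i \<and> h l = h i} else {l. l \<in> A \<and> l \<noteq> i \<and> h l = h i})"
        using that insert.hyps by auto
      then show ?thesis using insert.hyps by (simp add: add.commute)
    qed
    have "{l. l \<in> insert k A \<and> l \<noteq> k \<and> h l = h k} = {l. l \<in> A \<and> h l = h k}"
      using insert.hyps by auto
    moreover have "(\<Sum>i\<in>A. if h k = h i then X i x * X k x else 0) = X k x * (\<Sum>l | l \<in> A \<and> h l = h k. X l x)"
      using insert.hyps(1)
      by (simp add: sum_distrib_left sum.inter_filter[symmetric] mult.commute eq_commute)
    moreover have "(\<Sum>i\<in>A. \<Sum>l | l \<in> insert k A \<and> l \<noteq> i \<and> h l = h i. X i x * X l x) =
        (\<Sum>i\<in>A. \<Sum>l | l \<in> A \<and> l \<noteq> i \<and> h l = h i. X i x * X l x) +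
        (\<Sum>i\<in>A. if h k = h i then X i x * X k x else 0)"
      unfolding sum.distrib[symmetric] by (rule sum.cong[OF refl row])
    ultimately show ?thesis
      unfolding RQ RS sum.insert[OF insert.hyps] by (simp add: sum_distrib_left[symmetric])
  qed
  note step = indep_var_innovation_square[where q = ?Q and s = ?S and w = "\<lambda>f. f k", OF ind q w _ S1]
  show ?case
    unfolding eq using step IH S2 insert
    by (simp add: algebra_simps)
qed simp

section \<open>Tail bounds under weak moment assumptions\<close>

text \<open>Truncation at \<open>\<tau> = (N * L) powr (1/r)\<close>, where
  \<open>N = card I\<close>. One \<tau> of the threshold pays for the fluctuation of the truncated
  sum, the other for its bias. Chebyshev's inequality and the union bound for the event that some
  term is truncated cost \<open>m / L\<close> each.\<close>

lemma indep_vars_sum_weak_tail: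
  fixes X :: "'i \<Rightarrow> 'a \<Rightarrow> real"
  assumes I: "finite I" "I \<noteq> {}" and ind: "indep_vars (\<lambda>_. borel) X I"
    and X1: "\<And>i. i \<in> I \<Longrightarrow> integrable M (X i)" and X0: "\<And>i. i \<in> I \<Longrightarrow> expectation (X i) = 0"
    and Xr: "\<And>i. i \<in> I \<Longrightarrow> integrable M (\<lambda>x. \<bar>X i x\<bar> powr r)"
    and Xm: "\<And>i. i \<in> I \<Longrightarrow> expectation (\<lambda>x. \<bar>X i x\<bar> powr r) \<le> m"
    and r: "1 \<le> r" "r \<le> 2" and L: "0 < L" "m \<le> L"
  shows "prob {x \<in> space M. \<bar>\<Sum>i\<in>I. X i x\<bar> > 2 * (real (card I) * L) powr (1/r)} \<le> 2 * m / L"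
proof -
  define N where "N = real (card I)"
  define \<tau> where "\<tau> = (N * L) powr (1/r)"
  have N: "N > 0" using I by (simp add: N_def card_gt_0_iff)
  have \<tau>: "\<tau> > 0" using N L by (simp add: \<tau>_def)
  have \<tau>r: "\<tau> powr r = N * L" using N L r by (simp add: \<tau>_def powr_powr)
  have m: "m \<ge> 0"
  proof -
    obtain i where "i \<in> I" using I by auto
    then show ?thesis by (intro order_trans[OF Bochner_Integration.integral_nonneg Xm]) auto
  qed
  have meas [measurable]: "X i \<in> borel_measurable M" if "i \<in> I" for i
    using X1[OF that] by auto
  \<comment> \<open>Large values are set to zero rather than clipped, so the discarded part
    \<open>y - c y\<close> is either 0 or \<open>y\<close>.\<close>
  define c where "c = (\<lambda>y::real. if \<bar>y\<bar> \<le> \<tau> then y else 0)"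
  have [measurable]: "c \<in> borel_measurable borel" unfolding c_def by measurable
  have c_bd: "\<bar>c y\<bar> \<le> \<tau>" for y using \<tau> by (simp add: c_def)
  have cX: "integrable M (\<lambda>x. c (X i x))" if "i \<in> I" for i
    using that by (intro integrable_const_bound[of _ \<tau>]) (auto simp: c_bd)
  have cX2: "integrable M (\<lambda>x. (c (X i x))\<^sup>2)" if "i \<in> I" for i
  proof (intro integrable_const_bound[of _ "\<tau>\<^sup>2"])
    show "AE x in M. norm ((c (X i x))\<^sup>2) \<le> \<tau>\<^sup>2"
      using c_bd \<tau> by (auto simp: abs_le_square_iff[symmetric])
  qed (use that in measurable)
  have mean: "\<bar>expectation (\<lambda>x. c (X i x))\<bar> \<le> m * \<tau> / (N * L)" if i: "i \<in> I" for i
  proof -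
    \<comment> \<open>Beyond the level, \<open>r \<ge> 1\<close> bounds
      \<open>\<bar>y\<bar> powr (1 - r)\<close> by its value at \<tau>.\<close>
    have pt: "\<bar>y - c y\<bar> \<le> \<bar>y\<bar> powr r * (\<tau> / (N * L))" for y
    proof (cases "\<bar>y\<bar> \<le> \<tau>")
      case True
      then show ?thesis using \<tau> N L by (simp add: c_def)
    next
      case False
      have "\<bar>y\<bar> = \<bar>y\<bar> powr r * \<bar>y\<bar> powr (1 - r)"
        using False \<tau> by (simp add: powr_add[symmetric])
      also have "\<dots> \<le> \<bar>y\<bar> powr r * \<tau> powr (1 - r)"
        using False \<tau> r by (intro mult_left_mono powr_mono2') auto
      also have "\<tau> powr (1 - r) = \<tau> / (N * L)"
        using \<tau> \<tau>r by (simp add: powr_diff)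
      finally show ?thesis using False by (simp add: c_def)
    qed
    \<comment> \<open>As \<open>X i\<close> is centred, the mean of the truncated variable is minus
      the mean of the discarded part.\<close>
    have "\<bar>expectation (\<lambda>x. c (X i x))\<bar> = \<bar>expectation (\<lambda>x. X i x - c (X i x))\<bar>"
      using X0[OF i] X1[OF i] cX[OF i] by simp
    also have "\<dots> \<le> expectation (\<lambda>x. \<bar>X i x - c (X i x)\<bar>)"
      by (rule integral_abs_bound)
    also have "\<dots> \<le> expectation (\<lambda>x. \<bar>X i x\<bar> powr r * (\<tau> / (N * L)))"
      using X1[OF i] cX[OF i] Xr[OF i] pt by (intro integral_mono) auto
    also have "\<dots> = expectation (\<lambda>x. \<bar>X i x\<bar> powr r) * (\<tau> / (N * L))" by simp
    also have "\<dots> \<le> m * (\<tau> / (N * L))"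
      using Xm[OF i] \<tau> N L by (intro mult_right_mono) auto
    finally show ?thesis by simp
  qed
  have second: "expectation (\<lambda>x. (c (X i x))\<^sup>2) \<le> m * \<tau>\<^sup>2 / (N * L)" if i: "i \<in> I" for i
  proof -
    \<comment> \<open>Below the level, \<open>r \<le> 2\<close> bounds
      \<open>\<bar>y\<bar> powr (2 - r)\<close> by its value at \<tau>.\<close>
    have pt: "(c y)\<^sup>2 \<le> \<bar>y\<bar> powr r * (\<tau>\<^sup>2 / (N * L))" for y
    proof (cases "\<bar>y\<bar> \<le> \<tau> \<and> y \<noteq> 0")
      case False
      then show ?thesis using \<tau> N L by (auto simp: c_def)
    next
      case True
      have "(c y)\<^sup>2 = \<bar>y\<bar> powr 2" using True by (simp add: c_def)
      also have "\<dots> = \<bar>y\<bar> powr r * \<bar>y\<bar> powr (2 - r)"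
        using True by (simp add: powr_add[symmetric])
      also have "\<dots> \<le> \<bar>y\<bar> powr r * \<tau> powr (2 - r)"
        using True \<tau> r by (intro mult_left_mono powr_mono2) auto
      also have "\<tau> powr (2 - r) = \<tau>\<^sup>2 / (N * L)"
        using \<tau> \<tau>r by (simp add: powr_diff)
      finally show ?thesis .
    qed
    have "expectation (\<lambda>x. (c (X i x))\<^sup>2) \<le> expectation (\<lambda>x. \<bar>X i x\<bar> powr r * (\<tau>\<^sup>2 / (N * L)))"
      using cX2[OF i] Xr[OF i] pt by (intro integral_mono) auto
    also have "\<dots> = expectation (\<lambda>x. \<bar>X i x\<bar> powr r) * (\<tau>\<^sup>2 / (N * L))" by simp
    also have "\<dots> \<le> m * (\<tau>\<^sup>2 / (N * L))"
      using Xm[OF i] \<tau> N L by (intro mult_right_mono) auto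
    finally show ?thesis by simp
  qed
  define Y where "Y = (\<lambda>i x. c (X i x) - expectation (\<lambda>x. c (X i x)))"
  have indY: "indep_vars (\<lambda>_. borel) Y I"
    unfolding Y_def by (rule indep_vars_compose2[OF ind, where Y = "\<lambda>i y. c y - expectation (\<lambda>x. c (X i x))"]) measurable
  have Y1: "integrable M (Y i)" "expectation (Y i) = 0" if "i \<in> I" for i
    unfolding Y_def using cX[OF that] by (simp_all add: prob_space)
  have Y2: "integrable M (\<lambda>x. (Y i x)\<^sup>2)" if i: "i \<in> I" for i
    unfolding Y_def power2_diff using cX[OF that] cX2[OF that] by simp
  have varY: "expectation (\<lambda>x. (Y i x)\<^sup>2) \<le> m * \<tau>\<^sup>2 / (N * L)" if i: "i \<in> I" for i
    using variance_eq[OF cX[OF i] cX2[OF i]] second[OF i]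
    by (simp add: Y_def) (smt (verit) zero_le_power2)
  note sq = indep_vars_sum_square[OF I(1) indY Y1(1) Y2 Y1(2), simplified]
  have "prob {x\<in>space M. \<bar>\<Sum>i\<in>I. Y i x\<bar> \<ge> \<tau>} \<le> expectation (\<lambda>x. (\<Sum>i\<in>I. Y i x)\<^sup>2) / \<tau>\<^sup>2"
    using \<tau> sq Y1 by (intro second_moment_method) auto
  also have "\<dots> \<le> (\<Sum>i\<in>I. m * \<tau>\<^sup>2 / (N * L)) / \<tau>\<^sup>2"
    unfolding conjunct2[OF sq] by (intro divide_right_mono sum_mono varY) auto
  also have "\<dots> = m / L" using \<tau> N by (simp add: N_def[symmetric] field_simps)
  finally have p1: "prob {x\<in>space M. \<bar>\<Sum>i\<in>I. Y i x\<bar> \<ge> \<tau>} \<le> m / L" .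
  have p2i: "prob {x\<in>space M. \<bar>X i x\<bar> powr r \<ge> N * L} \<le> m / (N * L)" if i: "i \<in> I" for i
  proof -
    have "prob {x\<in>space M. \<bar>X i x\<bar> powr r \<ge> N * L} \<le> expectation (\<lambda>x. \<bar>X i x\<bar> powr r) / (N * L)"
      using Xr[OF i] N L by (intro integral_Markov_inequality_measure[of _ _ "{}"]) auto
    also have "\<dots> \<le> m / (N * L)" using Xm[OF i] N L by (intro divide_right_mono) auto
    finally show ?thesis .
  qed
  have "prob (\<Union>i\<in>I. {x\<in>space M. \<bar>X i x\<bar> powr r \<ge> N * L}) \<le>
      (\<Sum>i\<in>I. prob {x\<in>space M. \<bar>X i x\<bar> powr r \<ge> N * L})"
    using I by (intro finite_measure_subadditive_finite) auto
  also have "\<dots> \<le> (\<Sum>i\<in>I. m / (N * L))" by (intro sum_mono p2i)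
  also have "\<dots> = m / L" using N by (simp add: N_def[symmetric])
  finally have p2: "prob (\<Union>i\<in>I. {x\<in>space M. \<bar>X i x\<bar> powr r \<ge> N * L}) \<le> m / L" .
  \<comment> \<open>Off both exceptional events no term is truncated, so the sum is the centred
    truncated sum, smaller than \<tau> in absolute value, plus a bias that is at most \<tau> because
    \<open>m \<le> L\<close>.\<close>
  have "{x \<in> space M. \<bar>\<Sum>i\<in>I. X i x\<bar> > 2 * \<tau>} \<subseteq>
      {x\<in>space M. \<bar>\<Sum>i\<in>I. Y i x\<bar> \<ge> \<tau>} \<union> (\<Union>i\<in>I. {x\<in>space M. \<bar>X i x\<bar> powr r \<ge> N * L})"
  proof (intro subsetI, rule ccontr)
    fix x assume x: "x \<in> {x \<in> space M. \<bar>\<Sum>i\<in>I. X i x\<bar> > 2 * \<tau>}"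
      and nx: "x \<notin> {x\<in>space M. \<bar>\<Sum>i\<in>I. Y i x\<bar> \<ge> \<tau>} \<union> (\<Union>i\<in>I. {x\<in>space M. \<bar>X i x\<bar> powr r \<ge> N * L})"
    have "c (X i x) = X i x" if "i \<in> I" for i
    proof -
      have "\<not> \<tau> \<le> \<bar>X i x\<bar>"
      proof
        assume "\<tau> \<le> \<bar>X i x\<bar>"
        then have "\<tau> powr r \<le> \<bar>X i x\<bar> powr r" using \<tau> r by (intro powr_mono2) auto
        then show False using nx x that \<tau>r by auto
      qed
      then show ?thesis by (simp add: c_def)
    qed
    then have "(\<Sum>i\<in>I. X i x) = (\<Sum>i\<in>I. Y i x) + (\<Sum>i\<in>I. expectation (\<lambda>x. c (X i x)))"
      by (simp add: Y_def sum_subtractf)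
    moreover have "\<bar>\<Sum>i\<in>I. expectation (\<lambda>x. c (X i x))\<bar> \<le> \<tau>"
    proof -
      have "\<bar>\<Sum>i\<in>I. expectation (\<lambda>x. c (X i x))\<bar> \<le> (\<Sum>i\<in>I. m * \<tau> / (N * L))"
        by (rule order_trans[OF sum_abs]) (intro sum_mono mean)
      also have "\<dots> = m / L * \<tau>" using N by (simp add: N_def[symmetric])
      also have "\<dots> \<le> 1 * \<tau>" using L \<tau> by (intro mult_right_mono) auto
      finally show ?thesis by simp
    qed
    ultimately show False using x nx by auto
  qed
  then have "prob {x \<in> space M. \<bar>\<Sum>i\<in>I. X i x\<bar> > 2 * \<tau>} \<le> prob (
      {x\<in>space M. \<bar>\<Sum>i\<in>I. Y i x\<bar> \<ge> \<tau>} \<union> (\<Union>i\<in>I. {x\<in>space M. \<bar>X i x\<bar> powr r \<ge> N * L}))"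
    using I Y1 by (intro finite_measure_mono) (auto intro!: sets.finite_UN)
  also have "\<dots> \<le> m / L + m / L"
    using I Y1 p1 p2
    by (intro order_trans[OF measure_Un_le]) (auto intro!: sets.finite_UN)
  finally show ?thesis by (simp add: \<tau>_def N_def)
qed

text \<open>Multiplied by the group size \<open>b\<close>, the statistic is
  \<open>?D x + ?Q x\<close>. The diagonal part \<open>?D\<close> is allowed
  \<open>2 * L * b * p powr (1/r)\<close> and exceeds it with probability at most
  \<open>2 * m / L\<close>; the off-diagonal part \<open>?Q\<close> is allowed half of that and
  exceeds it with probability at most \<open>4 / L\<close>. Both allowances are proportional to
  \<open>b\<close>, which therefore cancels.\<close>

lemma normalized_sum_squares_tail:
  fixes W :: "'j \<times> 'i \<Rightarrow> 'a \<Rightarrow> real"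
  assumes J: "finite J" "J \<noteq> {}" and B: "finite B" "B \<noteq> {}"
    and ind: "indep_vars (\<lambda>_. borel) W (J \<times> B)"
    and W1: "\<And>k. k \<in> J \<times> B \<Longrightarrow> integrable M (W k)"
    and W2: "\<And>k. k \<in> J \<times> B \<Longrightarrow> integrable M (\<lambda>x. (W k x)\<^sup>2)"
    and W0: "\<And>k. k \<in> J \<times> B \<Longrightarrow> expectation (W k) = 0"
    and V1: "\<And>k. k \<in> J \<times> B \<Longrightarrow> expectation (\<lambda>x. (W k x)\<^sup>2) = 1"
    and Wr: "\<And>k. k \<in> J \<times> B \<Longrightarrow> integrable M (\<lambda>x. \<bar>(W k x)\<^sup>2 - 1\<bar> powr r)"
    and Wm: "\<And>k. k \<in> J \<times> B \<Longrightarrow> expectation (\<lambda>x. \<bar>(W k x)\<^sup>2 - 1\<bar> powr r) \<le> m"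
    and r: "1 \<le> r" "r \<le> 2" and L: "1 \<le> L" "m \<le> L"
  shows "prob {x \<in> space M.
      \<bar>\<Sum>j\<in>J. (\<Sum>i\<in>B. W (j, i) x)\<^sup>2 / real (card B) - 1\<bar> > 3 * L * real (card J) powr (1/r)}
    \<le> (2 * m + 4) / L"
proof -
  define p b I where "p = real (card J)" and "b = real (card B)" and "I = J \<times> B"
  have p: "p \<ge> 1" and b: "b \<ge> 1"
    using J B by (simp_all add: p_def b_def Suc_le_eq card_gt_0_iff)
  have cI: "real (card I) = p * b" by (simp add: p_def b_def I_def card_cartesian_product)
  have I: "finite I" "I \<noteq> {}" using J B by (auto simp: I_def)
  have meas [measurable]: "W k \<in> borel_measurable M" if "k \<in> I" for k
    using W1 that by (auto simp: I_def)
  let ?Q = "\<lambda>x. \<Sum>k\<in>I. \<Sum>l | l \<in> I \<and> l \<noteq> k \<and> fst l = fst k. W k x * W l x"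
  let ?D = "\<lambda>x. \<Sum>k\<in>I. (W k x)\<^sup>2 - 1"
  have Qm: "?Q \<in> borel_measurable M"
    by (intro borel_measurable_sum borel_measurable_times meas) auto
  have Dm: "?D \<in> borel_measurable M"
    by (intro borel_measurable_sum borel_measurable_diff borel_measurable_power
        borel_measurable_const meas)
  have eq: "b * (\<Sum>j\<in>J. (\<Sum>i\<in>B. W (j, i) x)\<^sup>2 / b - 1) = ?D x + ?Q x" for x
  proof -
    have "b * (\<Sum>j\<in>J. (\<Sum>i\<in>B. W (j, i) x)\<^sup>2 / b - 1) = (\<Sum>j\<in>J. (\<Sum>i\<in>B. W (j, i) x)\<^sup>2) - p * b"
      using b by (simp add: sum_subtractf sum_divide_distrib[symmetric] p_def field_simps)
    also have "\<dots> = ?D x + ?Q x"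
      unfolding sum_square_offdiagonal[where w = "\<lambda>k. W k x", OF J(1) B(1)] by (simp add: sum_subtractf cI I_def[symmetric])
    finally show ?thesis .
  qed
  have indD: "indep_vars (\<lambda>_. borel) (\<lambda>k x. (W k x)\<^sup>2 - 1) I"
    using ind unfolding I_def by (rule indep_vars_compose2[where Y = "\<lambda>_ y. y\<^sup>2 - 1"]) measurable
  have "prob {x \<in> space M. \<bar>?D x\<bar> > 2 * (real (card I) * L) powr (1/r)} \<le> 2 * m / L"
    using W2 V1 Wr Wm r L I
    by (intro indep_vars_sum_weak_tail[OF I indD]) (auto simp: I_def prob_space)
  moreover
  have "2 * (real (card I) * L) powr (1/r) \<le> 2 * L * b * p powr (1/r)"
  proof -
    \<comment> \<open>Any gain from averaging over a large group is given up here in exchange for a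
      bound uniform in \<open>b\<close>.\<close>
    have "(b * L) powr (1/r) \<le> (b * L) powr 1"
      using r b L by (intro powr_mono) (auto intro: order_trans[OF _ mult_mono[of 1 b 1 L]])
    then have "(p * (b * L)) powr (1/r) \<le> p powr (1/r) * (b * L)"
      using p b L by (simp add: powr_mult mult_left_mono)
    then show ?thesis by (simp add: cI mult_ac)
  qed
  then have "{x \<in> space M. \<bar>?D x\<bar> > 2 * L * b * p powr (1/r)} \<subseteq>
      {x \<in> space M. \<bar>?D x\<bar> > 2 * (real (card I) * L) powr (1/r)}"
    by (intro Collect_mono) linarith
  then have "prob {x \<in> space M. \<bar>?D x\<bar> > 2 * L * b * p powr (1/r)} \<le>
      prob {x \<in> space M. \<bar>?D x\<bar> > 2 * (real (card I) * L) powr (1/r)}"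
    using Dm by (intro finite_measure_mono) measurable
  ultimately have PD: "prob {x \<in> space M. \<bar>?D x\<bar> > 2 * L * b * p powr (1/r)} \<le> 2 * m / L"
    by (rule order_trans[rotated])
  have Qsq: "integrable M (\<lambda>x. (?Q x)\<^sup>2) \<and> expectation (\<lambda>x. (?Q x)\<^sup>2) \<le> 4 * real (card B) * real (card I)"
  proof (intro indep_vars_offdiagonal_square)
    fix k assume "k \<in> I"
    \<comment> \<open>The class of \<open>k\<close> is its row, a copy of \<open>B\<close>.\<close>
    then have "{l \<in> I. fst l = fst k} = Pair (fst k) ` B" by (auto simp: I_def)
    then show "card {l \<in> I. fst l = fst k} \<le> card B" by (simp add: card_image inj_on_def)
  qed (use ind W1 W2 W0 V1 I in \<open>auto simp: I_def\<close>)
  have T: "L * b * p powr (1/r) > 0" using L b p by simp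
  have "prob {x \<in> space M. \<bar>?Q x\<bar> \<ge> L * b * p powr (1/r)} \<le>
      expectation (\<lambda>x. (?Q x)\<^sup>2) / (L * b * p powr (1/r))\<^sup>2"
    using Qsq T Qm by (intro second_moment_method) auto
  also have "\<dots> \<le> 4 * b * (p * b) / (L * b * p powr (1/r))\<^sup>2"
    using Qsq by (intro divide_right_mono) (auto simp: b_def[symmetric] cI)
  also have "\<dots> \<le> 4 / L"
  proof -
    \<comment> \<open>\<open>r \<le> 2\<close> gives \<open>p \<le> p powr (2/r)\<close>, so
      \<open>?Q\<close>, of second moment at most \<open>4 * b * (p * b)\<close>, lives at the scale
      of the diagonal part. One of the two factors \<open>L\<close> in the denominator is given
      away.\<close>
    have "p powr 1 \<le> p powr (2/r)" using p r by (intro powr_mono) auto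
    also have "\<dots> = (p powr (1/r))\<^sup>2" using p by (simp add: power2_eq_square powr_add[symmetric])
    finally have "p * 1 \<le> (p powr (1/r))\<^sup>2 * L" using p L by (intro mult_mono) auto
    then have "4 * b * (p * b) * L \<le> 4 * (L * b * p powr (1/r))\<^sup>2"
      using b L by (simp add: power_mult_distrib power2_eq_square mult_ac mult_left_mono)
    moreover have "0 < (L * b * p powr (1/r))\<^sup>2" using T by (rule zero_less_power)
    moreover have "0 < L" using L by simp
    ultimately show ?thesis
      by (metis pos_divide_le_eq pos_le_divide_eq times_divide_eq_left)
  qed
  finally have PQ: "prob {x \<in> space M. \<bar>?Q x\<bar> \<ge> L * b * p powr (1/r)} \<le> 4 / L" .
  have "{x \<in> space M. \<bar>\<Sum>j\<in>J. (\<Sum>i\<in>B. W (j, i) x)\<^sup>2 / b - 1\<bar> > 3 * L * p powr (1/r)} \<subseteq>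
      {x \<in> space M. \<bar>?D x\<bar> > 2 * L * b * p powr (1/r)} \<union> {x \<in> space M. \<bar>?Q x\<bar> \<ge> L * b * p powr (1/r)}"
  proof
    fix x assume "x \<in> {x \<in> space M. \<bar>\<Sum>j\<in>J. (\<Sum>i\<in>B. W (j, i) x)\<^sup>2 / b - 1\<bar> > 3 * L * p powr (1/r)}"
    then have x: "x \<in> space M" "\<bar>\<Sum>j\<in>J. (\<Sum>i\<in>B. W (j, i) x)\<^sup>2 / b - 1\<bar> > 3 * L * p powr (1/r)" by auto
    have "b * (3 * L * p powr (1/r)) < b * \<bar>\<Sum>j\<in>J. (\<Sum>i\<in>B. W (j, i) x)\<^sup>2 / b - 1\<bar>"
      using x b by (intro mult_strict_left_mono) auto
    also have "\<dots> = \<bar>?D x + ?Q x\<bar>"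
      unfolding eq[symmetric] abs_mult using b by simp
    finally have "3 * (L * b * p powr (1/r)) < \<bar>?D x\<bar> + \<bar>?Q x\<bar>" by (simp add: mult_ac)
    then have "\<bar>?D x\<bar> > 2 * (L * b * p powr (1/r)) \<or> \<bar>?Q x\<bar> \<ge> L * b * p powr (1/r)" by linarith
    then show "x \<in> {x \<in> space M. \<bar>?D x\<bar> > 2 * L * b * p powr (1/r)} \<union>
        {x \<in> space M. \<bar>?Q x\<bar> \<ge> L * b * p powr (1/r)}"
      using x(1) by (auto simp: mult_ac)
  qed
  then have "prob {x \<in> space M. \<bar>\<Sum>j\<in>J. (\<Sum>i\<in>B. W (j, i) x)\<^sup>2 / b - 1\<bar> > 3 * L * p powr (1/r)} \<le>
      prob ({x \<in> space M. \<bar>?D x\<bar> > 2 * L * b * p powr (1/r)} \<union>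
        {x \<in> space M. \<bar>?Q x\<bar> \<ge> L * b * p powr (1/r)})"
    using Dm Qm by (intro finite_measure_mono) auto
  also have "\<dots> \<le> 2 * m / L + 4 / L"
    using Dm Qm PD PQ by (intro order_trans[OF measure_Un_le]) auto
  finally show ?thesis by (simp add: p_def b_def add_divide_distrib)
qed

end

section \<open>Medians and majorities\<close>

text \<open>The sorted entry at position \<open>?n div 2\<close> is never below the median: it is
  the median for odd length and the larger of the two averaged entries for even length. When it
  exceeds \<open>c\<close>, at most \<open>?n div 2\<close> entries are at most
  \<open>c\<close>.\<close>

lemma median_gt_imp_majority:
  assumes "xs \<noteq> []" "median xs > c"
  shows "length xs \<le> 2 * length (filter (\<lambda>x. x > c) xs)"
proof -
  let ?ys = "sort xs" and ?n = "length xs"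
  have n: "?n > 0" using assms by simp
  have "\<not> ?ys ! (?n div 2) \<le> c"
  proof (cases "odd ?n")
    case True
    then show ?thesis using assms by (simp add: median_def Let_def)
  next
    case False
    have "?ys ! (?n div 2 - 1) \<le> ?ys ! (?n div 2)"
      using n by (intro sorted_nth_mono) auto
    then show ?thesis using False assms by (simp add: median_def Let_def)
  qed
  then have "\<not> ?n div 2 < length (filter (\<lambda>x. x \<le> c) ?ys)"
    using sorted_nth_le_iff[of ?ys "?n div 2" c] n by simp
  moreover have "length (filter (\<lambda>x. x \<le> c) ?ys) = length (filter (\<lambda>x. x \<le> c) xs)"
    by (metis filter_sort length_sort)
  moreover have "length (filter (\<lambda>x. x \<le> c) xs) + length (filter (\<lambda>x. x > c) xs) = ?n"
    using sum_length_filter_compl[of "\<lambda>x. x \<le> c" xs] by (simp add: not_le)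
  ultimately show ?thesis by linarith
qed

text \<open>Dually, the lower middle entry never exceeds the median. For even length it has position
  \<open>?n div 2 - 1\<close>, so one half of the entries, not a strict majority, is what is
  guaranteed.\<close>

lemma median_le_imp_majority:
  assumes "xs \<noteq> []" "median xs \<le> c"
  shows "length xs \<le> 2 * length (filter (\<lambda>x. x \<le> c) xs)"
proof -
  let ?ys = "sort xs" and ?n = "length xs"
  have n: "?n > 0" using assms by simp
  have len: "length (filter (\<lambda>x. x \<le> c) ?ys) = length (filter (\<lambda>x. x \<le> c) xs)"
    by (metis filter_sort length_sort)
  show ?thesis
  proof (cases "odd ?n")
    case True
    then have "?ys ! (?n div 2) \<le> c" using assms by (simp add: median_def Let_def)
    then have "?n div 2 < length (filter (\<lambda>x. x \<le> c) ?ys)"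
      using sorted_nth_le_iff[of ?ys "?n div 2" c] n by simp
    then show ?thesis using len by linarith
  next
    case False
    have "?ys ! (?n div 2 - 1) \<le> ?ys ! (?n div 2)"
      using n by (intro sorted_nth_mono) auto
    then have "?ys ! (?n div 2 - 1) \<le> c" using False assms by (simp add: median_def Let_def)
    moreover have "?n div 2 - 1 < ?n" using n by linarith
    ultimately have "?n div 2 - 1 < length (filter (\<lambda>x. x \<le> c) ?ys)"
      using sorted_nth_le_iff[of ?ys "?n div 2 - 1" c] by simp
    then show ?thesis using len False n by presburger
  qed
qed

lemma (in prob_space) indep_vars_majority:
  assumes J: "finite J" "J \<noteq> {}" and ind: "indep_vars (\<lambda>_. borel) S J"
    and A: "A \<in> sets borel" and q: "0 \<le> q" "q \<le> 1"
    and bd: "\<And>g. g \<in> J \<Longrightarrow> prob {x \<in> space M. S g x \<in> A} \<le> q"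
  shows "{x \<in> space M. card J \<le> 2 * card {g \<in> J. S g x \<in> A}} \<in> events"
    and "prob {x \<in> space M. card J \<le> 2 * card {g \<in> J. S g x \<in> A}} \<le> (2 * sqrt q) ^ card J"
proof -
  have [measurable]: "S g \<in> borel_measurable M" if "g \<in> J" for g
    using ind that by (auto simp: indep_vars_def)
  define \<T> where "\<T> = {T. T \<subseteq> J \<and> card J \<le> 2 * card T}"
  have fin: "finite \<T>" using J(1) unfolding \<T>_def by auto
  \<comment> \<open>Half of a nonempty \<open>J\<close> is nonempty; the finite intersections and
    the product formula need this.\<close>
  have ne: "T \<noteq> {}" "T \<subseteq> J" "finite T" if "T \<in> \<T>" for T
    using that J by (auto simp: \<T>_def intro: finite_subset)
  let ?E = "\<lambda>T. \<Inter>g\<in>T. S g -` A \<inter> space M"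
  have E: "?E T \<in> events" if "T \<in> \<T>" for T
    using ne[OF that] A by (intro sets.finite_INT measurable_sets[where A = borel]) auto
  have eq: "{x \<in> space M. card J \<le> 2 * card {g \<in> J. S g x \<in> A}} = (\<Union>T\<in>\<T>. ?E T)"
  proof (intro set_eqI iffI)
    fix x assume "x \<in> {x \<in> space M. card J \<le> 2 * card {g \<in> J. S g x \<in> A}}"
    then show "x \<in> (\<Union>T\<in>\<T>. ?E T)"
      by (intro UN_I[of "{g \<in> J. S g x \<in> A}"]) (auto simp: \<T>_def)
  next
    fix x assume "x \<in> (\<Union>T\<in>\<T>. ?E T)"
    then obtain T where T: "T \<in> \<T>" "x \<in> ?E T" by (rule UN_E)
    have "T \<subseteq> {g \<in> J. S g x \<in> A}" using T ne[OF T(1)] by auto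
    then have "card T \<le> card {g \<in> J. S g x \<in> A}" using J(1) by (intro card_mono) auto
    then show "x \<in> {x \<in> space M. card J \<le> 2 * card {g \<in> J. S g x \<in> A}}"
      using T ne[OF T(1)] by (auto simp: \<T>_def)
  qed
  show "{x \<in> space M. card J \<le> 2 * card {g \<in> J. S g x \<in> A}} \<in> events"
    unfolding eq using fin E by (intro sets.finite_UN)
  have PE: "prob (?E T) \<le> sqrt q ^ card J" if "T \<in> \<T>" for T
  proof -
    have "prob (?E T) = (\<Prod>g\<in>T. prob (S g -` A \<inter> space M))"
      using ne[OF that] A by (intro indep_varsD[OF ind]) auto
    also have "\<dots> \<le> (\<Prod>g\<in>T. q)"
    proof (intro prod_mono conjI)
      fix g assume "g \<in> T"
      then have "prob {x \<in> space M. S g x \<in> A} \<le> q" using ne[OF that] by (intro bd) auto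
      moreover have "S g -` A \<inter> space M = {x \<in> space M. S g x \<in> A}" by auto
      ultimately show "prob (S g -` A \<inter> space M) \<le> q" by simp
    qed simp
    \<comment> \<open>The square root turns \<open>card T\<close> into \<open>2 * card T\<close>,
      which is at least \<open>card J\<close>; as \<open>sqrt q \<le> 1\<close>, the exponent may
      then be lowered.\<close>
    also have "\<dots> = sqrt q ^ (2 * card T)" using q by (simp add: power_mult)
    also have "\<dots> \<le> sqrt q ^ card J"
      using that q by (intro power_decreasing) (auto simp: \<T>_def)
    finally show ?thesis .
  qed
  have "prob (\<Union>T\<in>\<T>. ?E T) \<le> (\<Sum>T\<in>\<T>. prob (?E T))"
    using fin E by (intro finite_measure_subadditive_finite image_subsetI)
  also have "\<dots> \<le> (\<Sum>T\<in>\<T>. sqrt q ^ card J)" by (intro sum_mono PE)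
  also have "\<dots> = real (card \<T>) * sqrt q ^ card J" by simp
  also have "\<dots> \<le> 2 ^ card J * sqrt q ^ card J"
  proof (intro mult_right_mono)
    have "card \<T> \<le> card (Pow J)" using J(1) by (intro card_mono) (auto simp: \<T>_def)
    then have "real (card \<T>) \<le> real (2 ^ card J)" using J(1) by (simp only: card_Pow of_nat_le_iff)
    then show "real (card \<T>) \<le> 2 ^ card J" by simp
  qed (use q in simp)
  finally show "prob {x \<in> space M. card J \<le> 2 * card {g \<in> J. S g x \<in> A}} \<le> (2 * sqrt q) ^ card J"
    unfolding eq by (simp add: power_mult_distrib)
qed

section \<open>Symmetrised noise\<close>

text \<open>The noise part of \<open>Zdiff\<close>, with row and time in one index so that all
  differences form a single family.\<close>

definition noise_diff :: "nat \<Rightarrow> nat \<times> nat \<Rightarrow> mat \<Rightarrow> real" where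
  "noise_diff n k E = (E (fst k, snd k) - E (fst k, n - snd k + 1)) / sqrt 2"

text \<open>The times stop at \<open>n div 2\<close>, so that every mirrored column lies strictly
  beyond them; for odd \<open>n\<close> the middle column is left out.\<close>

definition noise_ix :: "nat \<Rightarrow> nat \<Rightarrow> (nat \<times> nat) set" where
  "noise_ix p n = {1..p} \<times> {1..n div 2}"

lemma noise_ix_in_mat_ix:
  assumes "k \<in> noise_ix p n"
  shows "k \<in> mat_ix p n" "(fst k, n - snd k + 1) \<in> mat_ix p n" "(fst k, n - snd k + 1) \<noteq> k"
  using assms by (auto simp: noise_ix_def mat_ix_def prod_eq_iff)

lemma noise_classD:
  assumes "prob_space P" "distr P borel X \<in> noise_class \<alpha> K" "X \<in> borel_measurable P"
  shows "integrable P X" "(\<integral>x. X x \<partial>P) = 0"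
    "integrable P (\<lambda>x. (X x)\<^sup>2)" "(\<integral>x. (X x)\<^sup>2 \<partial>P) = 1"
    "integrable P (\<lambda>x. \<bar>X x / K\<bar> powr \<alpha>)" "(\<integral>x. \<bar>X x / K\<bar> powr \<alpha> \<partial>P) \<le> 1"
proof -
  note [measurable] = assms(3)
  show "integrable P X" "integrable P (\<lambda>x. (X x)\<^sup>2)" "integrable P (\<lambda>x. \<bar>X x / K\<bar> powr \<alpha>)"
    using assms(2) by (simp_all add: noise_class_def integrable_distr_eq)
  show "(\<integral>x. X x \<partial>P) = 0" "(\<integral>x. (X x)\<^sup>2 \<partial>P) = 1" "(\<integral>x. \<bar>X x / K\<bar> powr \<alpha> \<partial>P) \<le> 1"
    using assms(2) by (simp_all add: noise_class_def integral_distr)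
qed

text \<open>The order \<open>r = min (\<alpha>/2) 2\<close> satisfies
  \<open>2 * r \<le> \<alpha>\<close>, so the \<alpha>-th noise moment controls the centred square,
  and the cap 2 keeps \<open>r\<close> within the range of the truncation bound. With
  \<open>w\<close> the scaled difference, the left side is at most 1 if
  \<open>\<bar>w\<bar> \<le> 1\<close>; otherwise the square dominates its centred version.\<close>

lemma abs_square_minus_one_powr_le:
  fixes a b K :: real
  assumes \<alpha>: "\<alpha> \<ge> 2" and K: "K > 0"
  shows "\<bar>((a - b) / sqrt 2)\<^sup>2 - 1\<bar> powr (min (\<alpha>/2) 2)
    \<le> 2 + (2 * K) powr \<alpha> * (\<bar>a / K\<bar> powr \<alpha> + \<bar>b / K\<bar> powr \<alpha>)"
proof -
  define r where "r = min (\<alpha>/2) 2"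
  define w where "w = (a - b) / sqrt 2"
  \<comment> \<open>The power of a maximum is at most the sum of the powers, which replaces a
    convexity inequality.\<close>
  define z where "z = max \<bar>a / K\<bar> \<bar>b / K\<bar>"
  have r: "r > 0" "2 * r \<le> \<alpha>" using \<alpha> by (auto simp: r_def)
  have w: "\<bar>w\<bar> \<le> 2 * K * z"
  proof -
    have "\<bar>a - b\<bar> / sqrt 2 \<le> \<bar>a - b\<bar> / 1" by (intro divide_left_mono) auto
    then have "\<bar>w\<bar> \<le> \<bar>a - b\<bar>" by (simp add: w_def)
    also have "\<dots> \<le> K * \<bar>a / K\<bar> + K * \<bar>b / K\<bar>" using K by simp
    also have "\<dots> \<le> K * z + K * z" using K unfolding z_def by (intro add_mono mult_left_mono) auto
    finally show ?thesis by simp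
  qed
  have "\<bar>w\<bar> powr \<alpha> \<le> (2 * K * z) powr \<alpha>" using w \<alpha> by (intro powr_mono2) auto
  also have "\<dots> = (2 * K) powr \<alpha> * z powr \<alpha>" using K by (simp add: powr_mult z_def)
  also have "\<dots> \<le> (2 * K) powr \<alpha> * (\<bar>a / K\<bar> powr \<alpha> + \<bar>b / K\<bar> powr \<alpha>)"
    by (intro mult_left_mono) (auto simp: z_def max_def)
  finally have wa: "\<bar>w\<bar> powr \<alpha> \<le> (2 * K) powr \<alpha> * (\<bar>a / K\<bar> powr \<alpha> + \<bar>b / K\<bar> powr \<alpha>)" .
  have "\<bar>w\<^sup>2 - 1\<bar> powr r \<le> 2 + \<bar>w\<bar> powr \<alpha>"
  proof (cases "\<bar>w\<bar> \<le> 1")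
    case True
    then have "w\<^sup>2 \<le> 1" by (simp add: abs_square_le_1)
    then have "\<bar>w\<^sup>2 - 1\<bar> powr r \<le> 1 powr r" using r by (intro powr_mono2) auto
    also have "\<dots> \<le> 2 + \<bar>w\<bar> powr \<alpha>" by (simp add: add_increasing2)
    finally show ?thesis .
  next
    case False
    then have "1 \<le> \<bar>w\<bar>" by simp
    then have "1 \<le> \<bar>w\<bar>\<^sup>2" by (rule one_le_power)
    then have "\<bar>w\<^sup>2 - 1\<bar> powr r \<le> (\<bar>w\<bar>\<^sup>2) powr r" using r by (intro powr_mono2) auto
    also have "\<bar>w\<bar>\<^sup>2 = \<bar>w\<bar> powr 2" using \<open>1 \<le> \<bar>w\<bar>\<close> by simp
    also have "(\<bar>w\<bar> powr 2) powr r = \<bar>w\<bar> powr (2 * r)" by (rule powr_powr)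
    also have "\<dots> \<le> \<bar>w\<bar> powr \<alpha>" using \<open>1 \<le> \<bar>w\<bar>\<close> r by (intro powr_mono) auto
    finally show ?thesis by simp
  qed
  then show ?thesis using wa by (simp add: w_def r_def)
qed

lemma noise_diff_props:
  assumes P: "P \<in> joint_noise_class \<alpha> K p n" and \<alpha>: "\<alpha> \<ge> 2" and K: "K > 0"
  shows "prob_space.indep_vars P (\<lambda>_. borel) (noise_diff n) (noise_ix p n)"
    and "k \<in> noise_ix p n \<Longrightarrow> integrable P (noise_diff n k)"
    and "k \<in> noise_ix p n \<Longrightarrow> integrable P (\<lambda>E. (noise_diff n k E)\<^sup>2)"
    and "k \<in> noise_ix p n \<Longrightarrow> (\<integral>E. noise_diff n k E \<partial>P) = 0"
    and "k \<in> noise_ix p n \<Longrightarrow> (\<integral>E. (noise_diff n k E)\<^sup>2 \<partial>P) = 1"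
    and "k \<in> noise_ix p n \<Longrightarrow> integrable P (\<lambda>E. \<bar>(noise_diff n k E)\<^sup>2 - 1\<bar> powr (min (\<alpha>/2) 2))"
    and "k \<in> noise_ix p n \<Longrightarrow>
      (\<integral>E. \<bar>(noise_diff n k E)\<^sup>2 - 1\<bar> powr (min (\<alpha>/2) 2) \<partial>P) \<le> 2 + 2 * (2 * K) powr \<alpha>"
proof -
  interpret prob_space P using P by (simp add: joint_noise_class_def)
  have ind: "indep_vars (\<lambda>_. borel) (\<lambda>i E. E i) (mat_ix p n)"
    using P by (simp add: joint_noise_class_def)
  have meas: "(\<lambda>E. E i) \<in> borel_measurable P" if "i \<in> mat_ix p n" for i
    using ind that by (auto simp: indep_vars_def)
  have D: "distr P borel (\<lambda>E. E i) \<in> noise_class \<alpha> K" if "i \<in> mat_ix p n" for i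
    using P that by (simp add: joint_noise_class_def)
  note nc = noise_classD[OF prob_space_axioms D meas]
  let ?k' = "\<lambda>k. (fst k, n - snd k + 1)"
  \<comment> \<open>The blocks \<open>{k, ?k' k}\<close> are pairwise disjoint, since the mirror
    image of a first-half time falls into the second half.\<close>
  have "indep_vars (\<lambda>k. PiM {k, ?k' k} (\<lambda>_. borel)) (\<lambda>k E. \<lambda>i\<in>{k, ?k' k}. E i) (noise_ix p n)"
    using noise_ix_in_mat_ix
    by (intro indep_vars_restrict[OF ind]) (auto simp: disjoint_family_on_def noise_ix_def)
  then have "indep_vars (\<lambda>_. borel)
      (\<lambda>k E. (\<lambda>f. (f k - f (?k' k)) / sqrt 2) (\<lambda>i\<in>{k, ?k' k}. E i)) (noise_ix p n)"
    by (rule indep_vars_compose2)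
      (intro borel_measurable_divide borel_measurable_diff borel_measurable_const
        measurable_component_singleton; simp)
  then show "indep_vars (\<lambda>_. borel) (noise_diff n) (noise_ix p n)"
    by (simp add: noise_diff_def[abs_def])
  assume k: "k \<in> noise_ix p n"
  note k1 = noise_ix_in_mat_ix(1)[OF k] and k2 = noise_ix_in_mat_ix(2)[OF k]
    and kne = noise_ix_in_mat_ix(3)[OF k]
  have eq: "noise_diff n k E = (E k - E (?k' k)) / sqrt 2" for E by (simp add: noise_diff_def)
  show W1: "integrable P (noise_diff n k)" "(\<integral>E. noise_diff n k E \<partial>P) = 0"
    unfolding eq[abs_def] using nc(1,2)[OF k1 k1] nc(1,2)[OF k2 k2] by simp_all
  \<comment> \<open>As a weighted sum of two independent centred entries with squared weights 1/2,
    the difference has unit variance by \<open>indep_vars_sum_square\<close>.\<close>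
  define c where "c = (\<lambda>i. if i = k then 1 / sqrt 2 else - 1 / sqrt 2 :: real)"
  have c2: "(c i)\<^sup>2 = 1/2" for i by (simp add: c_def power_divide)
  have indc: "indep_vars (\<lambda>_. borel) (\<lambda>i E. c i * E i) {k, ?k' k}"
    using k1 k2 by (intro indep_vars_compose2[where Y = "\<lambda>i y. c i * y", OF indep_vars_subset[OF ind]]) auto
  have eqc: "noise_diff n k E = (\<Sum>i\<in>{k, ?k' k}. c i * E i)" for E
    using kne by (simp add: eq c_def diff_divide_distrib)
  have "integrable P (\<lambda>E. (\<Sum>i\<in>{k, ?k' k}. c i * E i)\<^sup>2) \<and>
      expectation (\<lambda>E. (\<Sum>i\<in>{k, ?k' k}. c i * E i)\<^sup>2) = (\<Sum>i\<in>{k, ?k' k}. expectation (\<lambda>E. (c i * E i)\<^sup>2))"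
    using k1 k2 nc(1-3) by (intro indep_vars_sum_square[OF _ indc]) (auto simp: power_mult_distrib)
  moreover have "(\<Sum>i\<in>{k, ?k' k}. expectation (\<lambda>E. (c i * E i)\<^sup>2)) = 1"
    using kne k1 k2 nc(4) by (simp add: power_mult_distrib c2)
  ultimately show "integrable P (\<lambda>E. (noise_diff n k E)\<^sup>2)" "(\<integral>E. (noise_diff n k E)\<^sup>2 \<partial>P) = 1"
    unfolding eqc by simp_all
  let ?bd = "\<lambda>E. 2 + (2 * K) powr \<alpha> * (\<bar>E k / K\<bar> powr \<alpha> + \<bar>E (?k' k) / K\<bar> powr \<alpha>)"
  have bd: "\<bar>(noise_diff n k E)\<^sup>2 - 1\<bar> powr (min (\<alpha>/2) 2) \<le> ?bd E" for E
    unfolding eq by (rule abs_square_minus_one_powr_le[OF \<alpha> K])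
  have bdi: "integrable P ?bd" using nc(5)[OF k1 k1] nc(5)[OF k2 k2] by simp
  have [measurable]: "noise_diff n k \<in> borel_measurable P" using W1 by auto
  show Wi: "integrable P (\<lambda>E. \<bar>(noise_diff n k E)\<^sup>2 - 1\<bar> powr (min (\<alpha>/2) 2))"
    using bd by (intro Bochner_Integration.integrable_bound[OF bdi]) (auto intro: order_trans[OF _ abs_ge_self])
  have "(\<integral>E. \<bar>(noise_diff n k E)\<^sup>2 - 1\<bar> powr (min (\<alpha>/2) 2) \<partial>P) \<le> expectation ?bd"
    using Wi bdi bd by (intro integral_mono) auto
  also have "\<dots> = 2 + (2 * K) powr \<alpha> * (expectation (\<lambda>E. \<bar>E k / K\<bar> powr \<alpha>) + expectation (\<lambda>E. \<bar>E (?k' k) / K\<bar> powr \<alpha>))"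
    using nc(5)[OF k1 k1] nc(5)[OF k2 k2] by (simp add: prob_space)
  also have "\<dots> \<le> 2 + (2 * K) powr \<alpha> * (1 + 1)"
    using nc(6)[OF k1 k1] nc(6)[OF k2 k2] by (intro add_left_mono mult_left_mono add_mono) auto
  finally show "(\<integral>E. \<bar>(noise_diff n k E)\<^sup>2 - 1\<bar> powr (min (\<alpha>/2) 2) \<partial>P) \<le> 2 + 2 * (2 * K) powr \<alpha>"
    by simp
qed

section \<open>Group statistics\<close>

text \<open>Normalised to be comparable across scales: the sum over \<open>j\<close> of
  \<open>V\<close> is this statistic divided by the group size.\<close>

definition group_stat :: "nat \<Rightarrow> nat \<Rightarrow> nat set \<Rightarrow> mat \<Rightarrow> real" where
  "group_stat p n C X = (\<Sum>j\<in>{1..p}. (\<Sum>i\<in>C. Zdiff n X i j)\<^sup>2 / real (card C) - 1)"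

text \<open>The value of \<open>group_stat\<close> when the differenced means are \<open>a j\<close>
  throughout the group, as a function of the noise alone; \<open>a = (\<lambda>_. 0)\<close> is the
  null case.\<close>

definition drift_stat :: "nat \<Rightarrow> nat \<Rightarrow> nat set \<Rightarrow> (nat \<Rightarrow> real) \<Rightarrow> mat \<Rightarrow> real" where
  "drift_stat p n C a E =
     (\<Sum>j\<in>{1..p}. (\<Sum>i\<in>C. a j + noise_diff n (j, i) E)\<^sup>2 / real (card C) - 1)"

lemma num_groups_pos: "t \<in> grid n \<Longrightarrow> n \<ge> 2 \<Longrightarrow> num_groups n t \<ge> 1"
  using grid_bounds[of t n] by (simp add: num_groups_def Delta_def)

lemma equal_groupingD:
  assumes "equal_grouping n B" "t \<in> grid n" "g \<in> {1..num_groups n t}"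
  shows "B t g \<subseteq> {1..t}" "real (card (B t g)) = real t / real (num_groups n t)"
    "disjoint_family_on (B t) {1..num_groups n t}"
  using assms unfolding equal_grouping_def by blast+

lemma equal_grouping_subset:
  assumes n: "n \<ge> 2" and B: "equal_grouping n B" and t: "t \<in> grid n"
    and g: "g \<in> {1..num_groups n t}"
  shows "B t g \<subseteq> {1..n div 2}" "B t g \<noteq> {}"
proof -
  show "B t g \<subseteq> {1..n div 2}"
    using equal_groupingD(1)[OF B t g] grid_bounds[OF t n] by fastforce
  have "real (card (B t g)) > 0"
    using equal_groupingD(2)[OF B t g] grid_bounds[OF t n] num_groups_pos[OF t n] by simp
  then show "B t g \<noteq> {}" by auto
qed

text \<open>With \<open>m = t / G\<close>, each entry of the median is a \<open>group_stat\<close>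
  divided by \<open>m\<close>, and the factor \<open>t / G\<close> in the normalised test statistic
  undoes this division. Every scale is thus compared with the same constant \<open>c\<close>. The
  first claim serves false alarms, the second missed changes.\<close>

lemma A_MoM_threshold_imp_majority:
  assumes n: "n \<ge> 2" and B: "equal_grouping n B" and t: "t \<in> grid n" and c: "c > 0"
  defines "G \<equiv> num_groups n t"
  shows "A_MoM p n B X t / (c * real G) > 1 \<Longrightarrow>
      card {1..G} \<le> 2 * card {g \<in> {1..G}. group_stat p n (B t g) X \<in> {c<..}}"
    and "\<not> A_MoM p n B X t / (c * real G) > 1 \<Longrightarrow>
      card {1..G} \<le> 2 * card {g \<in> {1..G}. group_stat p n (B t g) X \<in> {..c}}"
proof -
  define m where "m = real t / real G"
  have G: "G \<ge> 1" using num_groups_pos[OF t n] by (simp add: G_def)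
  have t0: "t \<ge> 1" using grid_bounds[OF t n] by simp
  have m: "m > 0" using G t0 by (simp add: m_def)
  have card: "real (card (B t g)) = m" if "g \<in> {1..G}" for g
    using equal_groupingD(2)[OF B t, of g] that by (simp add: m_def G_def)
  have V: "(\<Sum>j\<in>{1..p}. V n B X t g j) = group_stat p n (B t g) X / m" if "g \<in> {1..G}" for g
  proof -
    have "real G / real t = 1 / m" using G t0 by (simp add: m_def)
    then show ?thesis
      unfolding V_def Zbar_def group_stat_def card[OF that] G_def[symmetric] sum_divide_distrib[of _ "{1..p}"]
      using m G by (intro sum.cong) (auto simp: power_divide power2_eq_square field_simps)
  qed
  let ?xs = "map (\<lambda>g. group_stat p n (B t g) X / m) [1..<G + 1]"
  have A: "A_MoM p n B X t = real t * median ?xs"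
  proof -
    have "map (\<lambda>g. \<Sum>j\<in>{1..p}. V n B X t g j) [1..<G + 1] = ?xs"
      by (intro map_cong refl V) auto
    then show ?thesis unfolding A_MoM_def G_def by (rule arg_cong)
  qed
  have thr: "A_MoM p n B X t / (c * real G) > 1 \<longleftrightarrow> median ?xs > c / m"
    unfolding A using G t0 c by (simp add: m_def field_simps)
  have ne: "?xs \<noteq> []" using G by simp
  have len: "length (filter Q ?xs) = card {g \<in> {1..G}. Q (group_stat p n (B t g) X / m)}" for Q
  proof -
    have "length (filter Q ?xs) = length (filter (\<lambda>g. Q (group_stat p n (B t g) X / m)) [1..<G + 1])"
      by (simp add: filter_map comp_def)
    also have "\<dots> = card ({g. Q (group_stat p n (B t g) X / m)} \<inter> set [1..<G + 1])"
      by (rule distinct_length_filter) simp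
    also have "{g. Q (group_stat p n (B t g) X / m)} \<inter> set [1..<G + 1] =
        {g \<in> {1..G}. Q (group_stat p n (B t g) X / m)}"
      by auto
    finally show ?thesis .
  qed
  have *: "y / m > c / m \<longleftrightarrow> y \<in> {c<..}" "y / m \<le> c / m \<longleftrightarrow> y \<in> {..c}" for y
    using m by (auto simp: divide_less_cancel divide_le_cancel)
  show "card {1..G} \<le> 2 * card {g \<in> {1..G}. group_stat p n (B t g) X \<in> {c<..}}"
    if "A_MoM p n B X t / (c * real G) > 1"
    using median_gt_imp_majority[OF ne, of "c / m"] that G unfolding thr len * by simp
  show "card {1..G} \<le> 2 * card {g \<in> {1..G}. group_stat p n (B t g) X \<in> {..c}}"
    if "\<not> A_MoM p n B X t / (c * real G) > 1"
    using median_le_imp_majority[OF ne, of "c / m"] that G unfolding thr not_less len * by simp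
qed

lemma group_stat_eq_drift_stat:
  assumes C: "C \<subseteq> {1..n div 2}"
    and drift: "\<And>i j. i \<in> C \<Longrightarrow> j \<in> {1..p} \<Longrightarrow> (\<theta> (j, i) - \<theta> (j, n - i + 1)) / sqrt 2 = a j"
  shows "group_stat p n C (\<lambda>i\<in>mat_ix p n. \<theta> i + E i) = drift_stat p n C a E"
proof -
  have "Zdiff n (\<lambda>i\<in>mat_ix p n. \<theta> i + E i) i j = a j + noise_diff n (j, i) E"
    if "i \<in> C" "j \<in> {1..p}" for i j
  proof -
    have "(j, i) \<in> noise_ix p n" using that C by (auto simp: noise_ix_def)
    note ix = noise_ix_in_mat_ix(1,2)[OF this]
    show ?thesis
      unfolding drift[OF that, symmetric] Zdiff_def noise_diff_def using ix
      by (simp add: add_divide_distrib[symmetric] del: add_divide_distrib)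
  qed
  then show ?thesis unfolding group_stat_def drift_stat_def by (intro sum.cong refl) simp
qed

text \<open>Disjoint groups read disjoint blocks of the differenced noise, and the drift is
  deterministic.\<close>

lemma indep_vars_drift_stat:
  assumes P: "P \<in> joint_noise_class \<alpha> K p n" and \<alpha>: "\<alpha> \<ge> 2" and K: "K > 0"
    and C: "\<And>g. g \<in> J \<Longrightarrow> C g \<subseteq> {1..n div 2}" and disj: "disjoint_family_on C J"
  shows "prob_space.indep_vars P (\<lambda>_. borel) (\<lambda>g. drift_stat p n (C g) a) J"
proof -
  interpret prob_space P using P by (simp add: joint_noise_class_def)
  let ?F = "\<lambda>g f. \<Sum>j\<in>{1..p}. (\<Sum>i\<in>C g. a j + f (j, i))\<^sup>2 / real (card (C g)) - 1 :: real"
  let ?R = "\<lambda>g E. \<lambda>k\<in>{1..p} \<times> C g. noise_diff n k E"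
  have "indep_vars (\<lambda>g. PiM ({1..p} \<times> C g) (\<lambda>_. borel)) ?R J"
    using C disj
    by (intro indep_vars_restrict[OF noise_diff_props(1)[OF P \<alpha> K]])
      (force simp: noise_ix_def disjoint_family_on_def)+
  then have "indep_vars (\<lambda>_. borel) (\<lambda>g E. ?F g (?R g E)) J"
    by (rule indep_vars_compose2)
      (intro borel_measurable_sum borel_measurable_divide borel_measurable_diff
        borel_measurable_add borel_measurable_power borel_measurable_const
        measurable_component_singleton; simp)
  moreover have "?F g (?R g E) = drift_stat p n (C g) a E" for g E
    unfolding drift_stat_def by (intro sum.cong refl) simp
  ultimately show ?thesis by (simp add: drift_stat_def[abs_def])
qed

section \<open>Tails of the group statistics\<close>

definition noise_moment_bound :: "real \<Rightarrow> real \<Rightarrow> real" where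
  "noise_moment_bound \<alpha> K = 2 + 2 * (2 * K) powr \<alpha>"

lemma drift_stat_zero_tail:
  assumes P: "P \<in> joint_noise_class \<alpha> K p n" and \<alpha>: "\<alpha> \<ge> 2" and K: "K > 0" and p: "p \<ge> 1"
    and C: "C \<subseteq> {1..n div 2}" "C \<noteq> {}" and L: "1 \<le> L" "noise_moment_bound \<alpha> K \<le> L"
  shows "measure P {E \<in> space P. \<bar>drift_stat p n C (\<lambda>_. 0) E\<bar> > 3 * L * real p powr (max (1/2) (2/\<alpha>))}
    \<le> (2 * noise_moment_bound \<alpha> K + 4) / L"
proof -
  interpret prob_space P using P by (simp add: joint_noise_class_def)
  note props = noise_diff_props[OF P \<alpha> K]
  have sub: "{1..p} \<times> C \<subseteq> noise_ix p n" using C by (auto simp: noise_ix_def)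
  \<comment> \<open>The moment order of the truncation bound becomes the exponent of
    \<open>p\<close> in the threshold.\<close>
  have r: "1 / min (\<alpha>/2) 2 = max (1/2) (2/\<alpha>)"
    using \<alpha> by (auto simp: min_def max_def field_simps)
  have "prob {E \<in> space P. \<bar>\<Sum>j\<in>{1..p}. (\<Sum>i\<in>C. noise_diff n (j, i) E)\<^sup>2 / real (card C) - 1\<bar>
      > 3 * L * real (card {1..p}) powr (1 / min (\<alpha>/2) 2)} \<le> (2 * noise_moment_bound \<alpha> K + 4) / L"
  proof (rule normalized_sum_squares_tail)
    show "finite C" using C(1) by (rule finite_subset) simp
    show "indep_vars (\<lambda>_. borel) (noise_diff n) ({1..p} \<times> C)"
      by (rule indep_vars_subset[OF props(1) sub])
  qed (use props(2-) sub C p \<alpha> L in \<open>auto simp: noise_moment_bound_def\<close>)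
  then show ?thesis unfolding drift_stat_def r by simp
qed

text \<open>Expanding the square gives \<open>H + 2 * ?Y E\<close> plus the null statistic, where
  \<open>?Y\<close> is linear in the noise with variance \<open>H\<close>. If
  \<open>\<bar>?Y E\<bar> < H / 4\<close> and the null statistic is at least \<open>- c\<close>, the
  value exceeds \<open>H / 2 - c\<close>, which is at least \<open>c\<close>. Chebyshev's inequality
  for \<open>?Y\<close> at level \<open>H / 4\<close> gives \<open>16 / H\<close>.\<close>

lemma drift_stat_lower_tail:
  fixes a :: "nat \<Rightarrow> real"
  assumes P: "P \<in> joint_noise_class \<alpha> K p n" and \<alpha>: "\<alpha> \<ge> 2" and K: "K > 0" and p: "p \<ge> 1"
    and C: "C \<subseteq> {1..n div 2}" "C \<noteq> {}" and L: "1 \<le> L" "noise_moment_bound \<alpha> K \<le> L"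
  defines "c \<equiv> 3 * L * real p powr (max (1/2) (2/\<alpha>))"
    and "H \<equiv> real (card C) * (\<Sum>j\<in>{1..p}. (a j)\<^sup>2)"
  assumes H: "H \<ge> 4 * c"
  shows "measure P {E \<in> space P. drift_stat p n C a E \<le> c} \<le> (2 * noise_moment_bound \<alpha> K + 4) / L + 16 / H"
proof -
  interpret prob_space P using P by (simp add: joint_noise_class_def)
  note props = noise_diff_props[OF P \<alpha> K]
  have fin: "finite C" using C(1) by (rule finite_subset) simp
  have m: "real (card C) > 0" using C fin by (simp add: card_gt_0_iff)
  have sub: "{1..p} \<times> C \<subseteq> noise_ix p n" using C by (auto simp: noise_ix_def)
  have c: "c > 0" using p L by (simp add: c_def)
  have H0: "H > 0" using H c by linarith
  \<comment> \<open>Measurability is read off from the independence lemma for a one-element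
    family.\<close>
  have [measurable]: "drift_stat p n C b \<in> borel_measurable P" for b
    using indep_vars_drift_stat[OF P \<alpha> K, of "{0::nat}" "\<lambda>_. C"] C
    by (auto simp: indep_vars_def disjoint_family_on_def)
  let ?X = "\<lambda>k E. a (fst k) * noise_diff n k E"
  let ?Y = "\<lambda>E. \<Sum>k\<in>{1..p} \<times> C. ?X k E"
  have Ym: "?Y \<in> borel_measurable P"
    using props(2) sub by (intro borel_measurable_sum borel_measurable_times) auto
  have indX: "indep_vars (\<lambda>_. borel) ?X ({1..p} \<times> C)"
    by (rule indep_vars_compose2[where Y = "\<lambda>k y. a (fst k) * y", OF indep_vars_subset[OF props(1) sub]]) auto
  have "integrable P (\<lambda>E. (?Y E)\<^sup>2) \<and> expectation (\<lambda>E. (?Y E)\<^sup>2) = (\<Sum>k\<in>{1..p} \<times> C. expectation (\<lambda>E. (?X k E)\<^sup>2))"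
    using fin props(2-4) sub
    by (intro indep_vars_sum_square[OF _ indX]) (auto simp: power_mult_distrib)
  moreover have "(\<Sum>k\<in>{1..p} \<times> C. expectation (\<lambda>E. (?X k E)\<^sup>2)) = (\<Sum>k\<in>{1..p} \<times> C. (a (fst k))\<^sup>2)"
    using props(5) sub by (intro sum.cong) (auto simp: power_mult_distrib)
  moreover have "(\<Sum>k\<in>{1..p} \<times> C. (a (fst k))\<^sup>2) = H"
    unfolding sum.cartesian_product' H_def by (simp add: sum_distrib_left)
  ultimately have Y2: "integrable P (\<lambda>E. (?Y E)\<^sup>2)" "expectation (\<lambda>E. (?Y E)\<^sup>2) = H" by simp_all
  have "prob {E \<in> space P. \<bar>?Y E\<bar> \<ge> H / 4} \<le> expectation (\<lambda>E. (?Y E)\<^sup>2) / (H / 4)\<^sup>2"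
    using Y2 H0 Ym by (intro second_moment_method) auto
  also have "\<dots> = 16 / H" unfolding Y2(2) using H0 by (simp add: power2_eq_square)
  finally have PY: "prob {E \<in> space P. \<bar>?Y E\<bar> \<ge> H / 4} \<le> 16 / H" .
  have dec: "drift_stat p n C a E = H + 2 * ?Y E + drift_stat p n C (\<lambda>_. 0) E" for E
  proof -
    let ?S = "\<lambda>j. \<Sum>i\<in>C. noise_diff n (j, i) E"
    have "drift_stat p n C a E = (\<Sum>j\<in>{1..p}. real (card C) * (a j)\<^sup>2 + 2 * (a j * ?S j) + ((?S j)\<^sup>2 / real (card C) - 1))"
      unfolding drift_stat_def
    proof (intro sum.cong refl)
      fix j
      have "(\<Sum>i\<in>C. a j + noise_diff n (j, i) E) = real (card C) * a j + ?S j"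
        by (simp add: sum.distrib)
      then show "(\<Sum>i\<in>C. a j + noise_diff n (j, i) E)\<^sup>2 / real (card C) - 1 =
          real (card C) * (a j)\<^sup>2 + 2 * (a j * ?S j) + ((?S j)\<^sup>2 / real (card C) - 1)"
        using m by (simp add: power2_eq_square field_simps)
    qed
    also have "\<dots> = H + 2 * (\<Sum>j\<in>{1..p}. a j * ?S j) + (\<Sum>j\<in>{1..p}. (?S j)\<^sup>2 / real (card C) - 1)"
      unfolding sum.distrib H_def by (simp add: sum_distrib_left)
    also have "(\<Sum>j\<in>{1..p}. a j * ?S j) = ?Y E"
      unfolding sum.cartesian_product' by (simp add: sum_distrib_left)
    finally show ?thesis by (simp add: drift_stat_def)
  qed
  have "{E \<in> space P. drift_stat p n C a E \<le> c} \<subseteq>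
    {E \<in> space P. \<bar>drift_stat p n C (\<lambda>_. 0) E\<bar> > c} \<union> {E \<in> space P. \<bar>?Y E\<bar> \<ge> H / 4}"
  proof (intro subsetI, rule ccontr)
    fix E assume "E \<in> {E \<in> space P. drift_stat p n C a E \<le> c}"
      "E \<notin> {E \<in> space P. \<bar>drift_stat p n C (\<lambda>_. 0) E\<bar> > c} \<union> {E \<in> space P. \<bar>?Y E\<bar> \<ge> H / 4}"
    then have "drift_stat p n C a E \<le> c" "\<bar>drift_stat p n C (\<lambda>_. 0) E\<bar> \<le> c" "\<bar>?Y E\<bar> < H / 4"
      by (auto simp only: mem_Collect_eq Un_iff not_less not_le)
    then show False using dec[of E] H by linarith
  qed
  then have "prob {E \<in> space P. drift_stat p n C a E \<le> c} \<le>
    prob ({E \<in> space P. \<bar>drift_stat p n C (\<lambda>_. 0) E\<bar> > c} \<union> {E \<in> space P. \<bar>?Y E\<bar> \<ge> H / 4})"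
    using Ym by (intro finite_measure_mono) auto
  also have "\<dots> \<le> prob {E \<in> space P. \<bar>drift_stat p n C (\<lambda>_. 0) E\<bar> > c} + prob {E \<in> space P. \<bar>?Y E\<bar> \<ge> H / 4}"
    using Ym by (intro measure_Un_le) auto
  also have "\<dots> \<le> (2 * noise_moment_bound \<alpha> K + 4) / L + 16 / H"
    using drift_stat_zero_tail[OF P \<alpha> K p C L] PY unfolding c_def by (intro add_mono)
  finally show ?thesis .
qed

section \<open>The number of groups and summation over the dyadic grid\<close>

text \<open>The ceiling costs a factor of at most 2. The lower bound makes the errors summable over
  the grid; the upper bound limits how thinly the signal is split under the alternative.\<close>

lemma Delta_bounds:
  assumes n: "n \<ge> 2"
  defines "x \<equiv> ln (ln (8 * real n))"
  shows "x \<ge> 1/2" "8 * x \<le> real (Delta n)" "real (Delta n) \<le> 16 * x"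
proof -
  have "exp (2::real) \<le> 16"
  proof -
    have "exp (2::real) = exp 1 * exp 1" by (simp flip: exp_add)
    also have "\<dots> \<le> 4 * 4" using exp_le by (intro mult_mono) auto
    finally show ?thesis by simp
  qed
  then have "ln 16 \<ge> (2::real)" by (simp add: ln_ge_iff)
  also have "ln 16 \<le> ln (8 * real n)" using n by simp
  finally have l: "ln (8 * real n) \<ge> 2" .
  have "1/2 \<le> ln (2::real)" using ln2_ge_two_thirds by simp
  also have "ln 2 \<le> x" using l by (simp add: x_def)
  finally show x: "x \<ge> 1/2" .
  \<comment> \<open>From \<open>x \<ge> 1/2\<close> the exponent is nonnegative, so the conversion
    to \<open>nat\<close> in \<open>Delta\<close> is exact.\<close>
  have "log 2 (1/2) \<le> log 2 x" using x by simp
  then have "log 2 x \<ge> -1" by (simp add: log_divide)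
  then have nonneg: "3 + \<lceil>log 2 x\<rceil> \<ge> 0" by linarith
  have D: "real (Delta n) = 2 powr real_of_int (3 + \<lceil>log 2 x\<rceil>)"
    unfolding Delta_def x_def[symmetric]
    using nonneg powr_realpow[of 2 "nat (3 + \<lceil>log 2 x\<rceil>)"] by simp
  have x2: "2 powr (log 2 x) = x" using x by simp
  have "2 powr (3 + log 2 x) \<le> real (Delta n)" unfolding D by (intro powr_mono) auto
  then show "8 * x \<le> real (Delta n)" by (simp add: powr_add x2)
  have "real (Delta n) \<le> 2 powr (4 + log 2 x)" unfolding D by (intro powr_mono) linarith+
  then show "real (Delta n) \<le> 16 * x" by (simp add: powr_add x2)
qed

text \<open>A power with exponent \<open>min (2 ^ k) (Delta n)\<close> is at most the sum of the two
  powers. The first ones form a geometric series of total at most \<open>2 * u\<close>. The second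
  is the same for all scales and at most \<open>u / l\<close>, while there are at most
  \<open>2 * l\<close> scales, where \<open>l = ln (8 * real n)\<close>.\<close>

lemma grid_error_sum:
  fixes u :: real
  assumes n: "n \<ge> 2" and u: "0 \<le> u" "u \<le> 1/4"
  shows "(\<Sum>t\<in>grid n. u ^ num_groups n t) \<le> 4 * u"
proof -
  define N where "N = nat \<lfloor>log 2 (real n / 2)\<rfloor>"
  define l where "l = ln (8 * real n)"
  have log0: "log 2 (real n / 2) \<ge> 0" using n by simp
  have grid: "grid n = (\<lambda>k. 2 ^ k) ` {..N}"
    using log0 by (auto simp: grid_def N_def le_nat_iff)
  have sub: "(\<Sum>t\<in>grid n. u ^ num_groups n t) \<le> (\<Sum>k\<le>N. u * u ^ k + u ^ Delta n)"
  proof -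
    have "(\<Sum>t\<in>grid n. u ^ num_groups n t) = (\<Sum>k\<le>N. u ^ min (2 ^ k) (Delta n))"
      unfolding grid by (subst sum.reindex) (auto simp: inj_on_def num_groups_def)
    also have "\<dots> \<le> (\<Sum>k\<le>N. u * u ^ k + u ^ Delta n)"
    proof (intro sum_mono)
      fix k
      \<comment> \<open>\<open>2 ^ k \<ge> k + 1\<close>; the extra factor \<open>u\<close> keeps
        the total proportional to \<open>u\<close>.\<close>
      have "u ^ (2 ^ k) \<le> u ^ Suc k"
        using u by (intro power_decreasing) (auto simp: Suc_le_eq)
      then show "u ^ min (2 ^ k) (Delta n) \<le> u * u ^ k + u ^ Delta n"
        using u by (auto simp: min_def add_increasing add_increasing2)
    qed
    finally show ?thesis .
  qed
  have geo: "(\<Sum>k\<le>N. u * u ^ k) \<le> 2 * u"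
  proof -
    have "(\<Sum>k\<le>N. u * u ^ k) \<le> (\<Sum>k\<le>N. u * (1/2) ^ k)"
      using u by (intro sum_mono mult_left_mono power_mono) auto
    also have "\<dots> = u * (\<Sum>k\<le>N. (1/2) ^ k)" by (simp add: sum_distrib_left)
    also have "\<dots> \<le> u * 2"
      using u by (intro mult_left_mono) (simp_all add: sum_gp_multiplied sum_gp0)
    finally show ?thesis by simp
  qed
  note D = Delta_bounds[OF n]
  have l: "l > 0" using n by (simp add: l_def)
  have uD: "u ^ Delta n \<le> u / l"
  proof -
    have D1: "real (Delta n) - 1 \<ge> ln l" using D by (simp add: l_def)
    have "Delta n > 0" by (simp add: Delta_def)
    then have "u ^ Delta n = u * u ^ (Delta n - 1)" by (simp add: power_eq_if)
    \<comment> \<open>One factor \<open>u\<close> is held back. The others are at most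
      \<open>exp (-1)\<close>, and there are at least \<open>ln l\<close> of them, which produces
      \<open>1 / l\<close>.\<close>
    also have "u ^ (Delta n - 1) \<le> exp (-1) ^ (Delta n - 1)"
    proof (intro power_mono)
      have "exp 1 \<le> (4::real)" using exp_le by simp
      then have "1 / 4 \<le> exp (-1::real)" by (simp add: exp_minus field_simps)
      then show "u \<le> exp (-1)" using u by simp
    qed (use u in simp)
    also have "exp (-1) ^ (Delta n - 1) = exp (- (real (Delta n) - 1))"
      using \<open>Delta n > 0\<close> by (simp add: exp_of_nat_mult[symmetric] of_nat_diff)
    also have "\<dots> \<le> exp (- ln l)" using D1 by simp
    also have "\<dots> = 1 / l" using l by (simp add: exp_minus field_simps)
    finally show ?thesis using u by (simp add: mult_left_mono)
  qed
  have cnt: "real N + 1 \<le> 2 * l"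
  proof -
    have "real N \<le> log 2 (real n / 2)" using log0 by (simp add: N_def)
    also have "\<dots> = log 2 (real n) - 1" using n by (simp add: log_divide)
    finally have "real N + 1 \<le> ln (real n) / ln 2" by (simp add: log_def)
    also have "\<dots> \<le> ln (real n) / (1/2)"
      using n ln2_ge_two_thirds by (intro divide_left_mono) auto
    also have "\<dots> \<le> 2 * l" using n by (simp add: l_def)
    finally show ?thesis .
  qed
  have "(\<Sum>k\<le>N. u ^ Delta n) \<le> 2 * u"
  proof -
    have "(\<Sum>k\<le>N. u ^ Delta n) = (real N + 1) * u ^ Delta n" by simp
    also have "\<dots> \<le> (2 * l) * (u / l)" using cnt uD u l by (intro mult_mono) auto
    finally show ?thesis using l by simp
  qed
  then show ?thesis using sub geo by (simp add: sum.distrib)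
qed

section \<open>Error probabilities of the test\<close>

lemma dense_test_eq_of_bool:
  assumes n: "n \<ge> 2"
  shows "dense_test \<alpha> C\<^sub>1 p n B X =
    of_bool (\<exists>t\<in>grid n. A_MoM p n B X t / threshold \<alpha> C\<^sub>1 p n t > 1)"
  unfolding dense_test_def using one_in_grid[OF n] by (subst Max_gr_iff) (auto simp: finite_grid)

text \<open>Moves a testing error from the law of the data to the noise space, where it is dominated
  by the probability of a bad event. It is applied to the test and to one minus the test.\<close>

lemma nn_integral_law_le:
  assumes P: "P \<in> joint_noise_class \<alpha> K p n" and f: "f \<in> borel_measurable (mat_borel p n)"
    and S: "S \<in> sets P" and le: "measure P S \<le> e"
    and pt: "\<And>E. E \<in> space P \<Longrightarrow> f (\<lambda>i\<in>mat_ix p n. \<theta> i + E i) \<le> indicator S E"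
  shows "(\<integral>\<^sup>+X. ennreal (f X) \<partial>law p n \<theta> P) \<le> ennreal e"
proof -
  interpret prob_space P using P by (simp add: joint_noise_class_def)
  have "indep_vars (\<lambda>_. borel) (\<lambda>i E. E i) (mat_ix p n)"
    using P by (simp add: joint_noise_class_def)
  then have "(\<lambda>E. E i) \<in> borel_measurable P" if "i \<in> mat_ix p n" for i
    using that by (auto simp: indep_vars_def)
  then have shift: "(\<lambda>E. \<lambda>i\<in>mat_ix p n. \<theta> i + E i) \<in> measurable P (mat_borel p n)"
    unfolding mat_borel_def by (intro measurable_restrict borel_measurable_add) auto
  have "(\<integral>\<^sup>+X. ennreal (f X) \<partial>law p n \<theta> P) = (\<integral>\<^sup>+E. ennreal (f (\<lambda>i\<in>mat_ix p n. \<theta> i + E i)) \<partial>P)"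
    unfolding law_def using shift f by (intro nn_integral_distr) auto
  also have "\<dots> \<le> (\<integral>\<^sup>+E. indicator S E \<partial>P)"
  proof (intro nn_integral_mono)
    fix E assume "E \<in> space P"
    then have "ennreal (f (\<lambda>i\<in>mat_ix p n. \<theta> i + E i)) \<le> ennreal (indicator S E)"
      by (intro ennreal_leI pt)
    then show "ennreal (f (\<lambda>i\<in>mat_ix p n. \<theta> i + E i)) \<le> indicator S E"
      by (simp add: ennreal_indicator)
  qed
  also have "\<dots> = ennreal (measure P S)" using S by (simp add: emeasure_eq_measure)
  also have "\<dots> \<le> ennreal e" using le by (rule ennreal_leI)
  finally show ?thesis .
qed

text \<open>A false alarm at a scale forces half of its groups to be bad. The union bound over the
  grid costs only a factor 4, by \<open>grid_error_sum\<close> with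
  \<open>u = 2 * sqrt q\<close>.\<close>

lemma dense_test_null_error:
  assumes P: "P \<in> joint_noise_class \<alpha> K p n" and \<alpha>: "\<alpha> \<ge> 2" and K: "K > 0" and p: "p \<ge> 1" and n: "n \<ge> 2"
    and B: "equal_grouping n B" and \<theta>: "\<theta> \<in> null_space p n"
    and L: "1 \<le> L" "noise_moment_bound \<alpha> K \<le> L"
    and q: "(2 * noise_moment_bound \<alpha> K + 4) / L \<le> q" "0 \<le> q" "2 * sqrt q \<le> 1/4"
  shows "(\<integral>\<^sup>+X. ennreal (dense_test \<alpha> (3 * L) p n B X) \<partial>law p n \<theta> P) \<le> ennreal (4 * (2 * sqrt q))"
proof -
  interpret prob_space P using P by (simp add: joint_noise_class_def)
  define c where "c = 3 * L * real p powr (max (1/2) (2/\<alpha>))"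
  have c: "c > 0" using p L by (simp add: c_def)
  have thr: "threshold \<alpha> (3 * L) p n t = c * real (num_groups n t)" for t
    by (simp add: threshold_def c_def)
  \<comment> \<open>The bad event at scale \<open>t\<close> is stated for pure noise, so it does not
    involve \<theta>.\<close>
  define S where "S t = {E \<in> space P. card {1..num_groups n t} \<le>
    2 * card {g \<in> {1..num_groups n t}. drift_stat p n (B t g) (\<lambda>_. 0) E \<in> {c<..}}}" for t
  have "sqrt q \<le> 1" using q(3) real_sqrt_ge_zero[OF q(2)] by linarith
  then have q1: "q \<le> 1" by simp
  note sub = equal_grouping_subset[OF n B]
  have St: "S t \<in> events \<and> prob (S t) \<le> (2 * sqrt q) ^ num_groups n t" if t: "t \<in> grid n" for t
  proof -
    have J: "finite {1..num_groups n t}" "{1..num_groups n t} \<noteq> {}"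
      using num_groups_pos[OF t n] by auto
    have ind: "indep_vars (\<lambda>_. borel) (\<lambda>g. drift_stat p n (B t g) (\<lambda>_. 0)) {1..num_groups n t}"
      using num_groups_pos[OF t n]
      by (intro indep_vars_drift_stat[OF P \<alpha> K sub(1)[OF t]] equal_groupingD(3)[OF B t, of 1]) auto
    have bd: "prob {E \<in> space P. drift_stat p n (B t g) (\<lambda>_. 0) E \<in> {c<..}} \<le> q"
      if g: "g \<in> {1..num_groups n t}" for g
    proof -
      have [measurable]: "drift_stat p n (B t g) (\<lambda>_. 0) \<in> borel_measurable P"
        using ind g by (auto simp: indep_vars_def)
      have "prob {E \<in> space P. drift_stat p n (B t g) (\<lambda>_. 0) E \<in> {c<..}} \<le>
          prob {E \<in> space P. \<bar>drift_stat p n (B t g) (\<lambda>_. 0) E\<bar> > c}"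
        by (intro finite_measure_mono) auto
      then show ?thesis
        using drift_stat_zero_tail[OF P \<alpha> K p sub[OF t g] L] q(1) by (simp add: c_def)
    qed
    have A: "{c<..} \<in> sets borel" by simp
    note majority = indep_vars_majority[where A = "{c<..}", OF J ind A q(2) q1 bd]
    have "prob (S t) \<le> (2 * sqrt q) ^ card {1..num_groups n t}"
      unfolding S_def by (rule majority(2))
    moreover have "S t \<in> events"
      unfolding S_def by (rule majority(1))
    ultimately show ?thesis by simp
  qed
  show ?thesis
  proof (rule nn_integral_law_le[OF P measurable_dense_test[OF n B], where S = "\<Union>t\<in>grid n. S t"])
    show "(\<Union>t\<in>grid n. S t) \<in> events" using St finite_grid by (intro sets.finite_UN) auto
    have "prob (\<Union>t\<in>grid n. S t) \<le> (\<Sum>t\<in>grid n. prob (S t))"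
      using St finite_grid by (intro finite_measure_subadditive_finite) auto
    also have "\<dots> \<le> (\<Sum>t\<in>grid n. (2 * sqrt q) ^ num_groups n t)" using St by (intro sum_mono) auto
    also have "\<dots> \<le> 4 * (2 * sqrt q)" using q by (intro grid_error_sum[OF n]) auto
    finally show "prob (\<Union>t\<in>grid n. S t) \<le> 4 * (2 * sqrt q)" .
  next
    fix E assume E: "E \<in> space P"
    obtain \<mu> where \<mu>: "\<And>t j. t \<in> {1..n} \<Longrightarrow> j \<in> {1..p} \<Longrightarrow> \<theta> (j, t) = \<mu> j"
      using \<theta> by (auto simp: null_space_def)
    show "dense_test \<alpha> (3 * L) p n B (\<lambda>i\<in>mat_ix p n. \<theta> i + E i) \<le> indicator (\<Union>t\<in>grid n. S t) E"
    proof (cases "\<exists>t\<in>grid n. A_MoM p n B (\<lambda>i\<in>mat_ix p n. \<theta> i + E i) t / threshold \<alpha> (3 * L) p n t > 1")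
      case True
      then obtain t where t: "t \<in> grid n"
        and ex: "A_MoM p n B (\<lambda>i\<in>mat_ix p n. \<theta> i + E i) t / (c * real (num_groups n t)) > 1"
        by (auto simp: thr)
      have "group_stat p n (B t g) (\<lambda>i\<in>mat_ix p n. \<theta> i + E i) = drift_stat p n (B t g) (\<lambda>_. 0) E"
        if g: "g \<in> {1..num_groups n t}" for g
      proof (rule group_stat_eq_drift_stat[OF sub(1)[OF t g]])
        fix i j assume ij: "i \<in> B t g" "j \<in> {1..p}"
        have "i \<in> {1..n}" "n - i + 1 \<in> {1..n}" using sub(1)[OF t g] ij by (auto dest!: subsetD)
        then show "(\<theta> (j, i) - \<theta> (j, n - i + 1)) / sqrt 2 = 0" using \<mu> ij by simp
      qed
      then have "{g \<in> {1..num_groups n t}. group_stat p n (B t g) (\<lambda>i\<in>mat_ix p n. \<theta> i + E i) \<in> {c<..}} =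
          {g \<in> {1..num_groups n t}. drift_stat p n (B t g) (\<lambda>_. 0) E \<in> {c<..}}" by auto
      then have "E \<in> S t"
        using A_MoM_threshold_imp_majority(1)[OF n B t c ex] E by (simp add: S_def)
      then have "E \<in> (\<Union>t\<in>grid n. S t)" using t by blast
      then show ?thesis by (simp add: dense_test_eq_of_bool[OF n] del: UN_iff)
    qed (simp add: dense_test_eq_of_bool[OF n])
  qed
qed

text \<open>The constant 4 is a product of two factors 2: one because the distance \<open>h\<close>
  from the change to the nearer end is less than \<open>2 * t\<close>, one from the
  \<open>sqrt 2\<close> in the differences.\<close>

lemma alt_space_at_scale:
  assumes n: "n \<ge> 2" and t\<^sub>0: "t\<^sub>0 \<in> {1..n-1}" and \<theta>: "\<theta> \<in> alt_space_at t\<^sub>0 p n s \<rho>"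
  obtains t a where "t \<in> grid n" "real t * (\<Sum>j\<in>{1..p}. (a j)\<^sup>2) \<ge> \<rho>\<^sup>2 / 4"
    "\<And>i j. i \<in> {1..t} \<Longrightarrow> j \<in> {1..p} \<Longrightarrow> (\<theta> (j, i) - \<theta> (j, n - i + 1)) / sqrt 2 = a j"
proof -
  obtain \<mu>\<^sub>1 \<mu>\<^sub>2 where \<mu>: "\<And>t j. t \<in> {1..n} \<Longrightarrow> j \<in> {1..p} \<Longrightarrow> \<theta> (j, t) = (if t \<le> t\<^sub>0 then \<mu>\<^sub>1 j else \<mu>\<^sub>2 j)"
    and \<rho>: "real t\<^sub>0 * (real n - real t\<^sub>0) / real n * (L2_set (\<lambda>j. \<mu>\<^sub>1 j - \<mu>\<^sub>2 j) {1..p})\<^sup>2 \<ge> \<rho>\<^sup>2"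
    using \<theta> unfolding alt_space_at_def by blast
  define h where "h = min t\<^sub>0 (n - t\<^sub>0)"
  define \<delta> where "\<delta> = (\<Sum>j\<in>{1..p}. (\<mu>\<^sub>1 j - \<mu>\<^sub>2 j)\<^sup>2)"
  have h: "h \<ge> 1" "h \<le> t\<^sub>0" "h \<le> n - t\<^sub>0" "2 * h \<le> n" using t\<^sub>0 by (auto simp: h_def)
  have \<delta>0: "\<delta> \<ge> 0" by (simp add: \<delta>_def sum_nonneg)
  have L2: "(L2_set (\<lambda>j. \<mu>\<^sub>1 j - \<mu>\<^sub>2 j) {1..p})\<^sup>2 = \<delta>"
    using \<delta>0 by (simp add: L2_set_def \<delta>_def)
  obtain k where k: "2 ^ k \<le> h" "h < 2 ^ (k + 1)" using ex_power_ivl1[of 2 h] h by auto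
  define t :: nat where "t = 2 ^ k"
  have t: "t \<le> h" "h < 2 * t" using k by (simp_all add: t_def)
  show ?thesis
  proof (rule that[of t "\<lambda>j. (\<mu>\<^sub>1 j - \<mu>\<^sub>2 j) / sqrt 2"])
    have "2 * real t \<le> real n" using t h by linarith
    then have "2 ^ k \<le> real n / 2" by (simp add: t_def)
    then have "real k \<le> log 2 (real n / 2)" using n by (simp add: le_log_iff powr_realpow)
    then show "t \<in> grid n" by (auto simp: grid_def t_def le_floor_iff intro!: exI[of _ k])
  next
    have "real t\<^sub>0 * (real n - real t\<^sub>0) / real n \<le> real h"
    proof -
      \<comment> \<open>The product is symmetric under exchanging \<open>t\<^sub>0\<close> and
        \<open>n - t\<^sub>0\<close>, so either may be named \<open>h\<close>.\<close>
      have "real t\<^sub>0 * (real n - real t\<^sub>0) = real h * (real n - real h)"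
        using t\<^sub>0 by (auto simp: h_def min_def of_nat_diff algebra_simps)
      also have "\<dots> \<le> real h * real n" by (intro mult_left_mono) auto
      finally show ?thesis using n by (simp add: divide_le_eq)
    qed
    then have "\<rho>\<^sup>2 \<le> real h * \<delta>" using \<rho> \<delta>0 unfolding L2 by (meson mult_right_mono order_trans)
    also have "\<dots> \<le> (2 * real t) * \<delta>" using t \<delta>0 by (intro mult_right_mono) auto
    also have "\<delta> = 2 * (\<Sum>j\<in>{1..p}. ((\<mu>\<^sub>1 j - \<mu>\<^sub>2 j) / sqrt 2)\<^sup>2)"
      by (simp add: \<delta>_def power_divide sum_divide_distrib[symmetric])
    finally show "real t * (\<Sum>j\<in>{1..p}. ((\<mu>\<^sub>1 j - \<mu>\<^sub>2 j) / sqrt 2)\<^sup>2) \<ge> \<rho>\<^sup>2 / 4" by simp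
  next
    fix i j assume ij: "i \<in> {1..t}" "j \<in> {1..p}"
    have "i \<in> {1..n}" "i \<le> t\<^sub>0" using ij t h by auto
    \<comment> \<open>\<open>i \<le> h \<le> n - t\<^sub>0\<close> gives
      \<open>n - i + 1 \<ge> t\<^sub>0 + 1\<close>, so each pair of columns straddles the
      change.\<close>
    moreover have "n - i + 1 \<in> {1..n}" "\<not> n - i + 1 \<le> t\<^sub>0" using ij t h t\<^sub>0 by auto
    ultimately show "(\<theta> (j, i) - \<theta> (j, n - i + 1)) / sqrt 2 = (\<mu>\<^sub>1 j - \<mu>\<^sub>2 j) / sqrt 2"
      using \<mu> ij by simp
  qed
qed

text \<open>Detection at the single scale \<open>t\<close> suffices, so no sum over the grid
  appears; a miss there means that half of the groups stay below \<open>c\<close> despite the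
  drift.\<close>

lemma dense_test_alt_error:
  assumes P: "P \<in> joint_noise_class \<alpha> K p n" and \<alpha>: "\<alpha> \<ge> 2" and K: "K > 0" and p: "p \<ge> 1" and n: "n \<ge> 2"
    and B: "equal_grouping n B" and \<theta>: "\<theta> \<in> alt_space p n s \<rho>"
    and L: "1 \<le> L" "noise_moment_bound \<alpha> K \<le> L"
    and C2: "C\<^sub>2 \<ge> 768 * L"
    and \<rho>: "\<rho>\<^sup>2 \<ge> C\<^sub>2 * real p powr (max (1/2) (2/\<alpha>)) * ln (ln (8 * real n))"
    and q: "(2 * noise_moment_bound \<alpha> K + 4) / L + 1024 / C\<^sub>2 \<le> q" "0 \<le> q" "2 * sqrt q \<le> 1"
  shows "(\<integral>\<^sup>+X. ennreal (1 - dense_test \<alpha> (3 * L) p n B X) \<partial>law p n \<theta> P) \<le> ennreal (2 * sqrt q)"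
proof -
  interpret prob_space P using P by (simp add: joint_noise_class_def)
  define pb where "pb = real p powr (max (1/2) (2/\<alpha>))"
  define c where "c = 3 * L * pb"
  have pb: "pb \<ge> 1" using p by (simp add: pb_def ge_one_powr_ge_zero max.coboundedI1)
  have c: "c > 0" using pb L by (simp add: c_def)
  have C2p: "C\<^sub>2 > 0" using C2 L by simp
  have thr: "threshold \<alpha> (3 * L) p n t = c * real (num_groups n t)" for t
    by (simp add: threshold_def c_def pb_def)
  obtain t\<^sub>0 where "t\<^sub>0 \<in> {1..n-1}" "\<theta> \<in> alt_space_at t\<^sub>0 p n s \<rho>" using \<theta> by (auto simp: alt_space_def)
  then obtain t a where t: "t \<in> grid n" and ta: "real t * (\<Sum>j\<in>{1..p}. (a j)\<^sup>2) \<ge> \<rho>\<^sup>2 / 4"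
    and a: "\<And>i j. i \<in> {1..t} \<Longrightarrow> j \<in> {1..p} \<Longrightarrow> (\<theta> (j, i) - \<theta> (j, n - i + 1)) / sqrt 2 = a j"
    by (rule alt_space_at_scale[OF n]) blast
  define G where "G = num_groups n t"
  have G: "G \<ge> 1" using num_groups_pos[OF t n] by (simp add: G_def)
  have "sqrt q \<le> 1" using q(3) real_sqrt_ge_zero[OF q(2)] by linarith
  then have q1: "q \<le> 1" by simp
  note sub = equal_grouping_subset[OF n B t, folded G_def]
  \<comment> \<open>The signal \<open>\<rho>\<^sup>2 / 4\<close> is shared among at most
    \<open>Delta n \<le> 16 * x\<close> groups, and \<open>4 * 16 = 64\<close>; the iterated
    logarithm in the lower bound on \<rho> cancels against \<open>x\<close>.\<close>
  have H: "real (card (B t g)) * (\<Sum>j\<in>{1..p}. (a j)\<^sup>2) \<ge> C\<^sub>2 * pb / 64" if g: "g \<in> {1..G}" for g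
  proof -
    define x where "x = ln (ln (8 * real n))"
    have x: "x \<ge> 1/2" "real (Delta n) \<le> 16 * x" using Delta_bounds[OF n] by (simp_all add: x_def)
    have "real G \<le> real (Delta n)" by (simp add: G_def num_groups_def)
    then have Gx: "real G \<le> 16 * x" using x by linarith
    have "C\<^sub>2 * pb / 64 * real G \<le> C\<^sub>2 * pb / 64 * (16 * x)"
      using Gx C2p pb by (intro mult_left_mono) auto
    also have "\<dots> = (C\<^sub>2 * pb * x) / 4" by simp
    also have "\<dots> \<le> \<rho>\<^sup>2 / 4" using \<rho> by (simp add: pb_def x_def)
    also have "\<dots> \<le> real t * (\<Sum>j\<in>{1..p}. (a j)\<^sup>2)" by (rule ta)
    finally have "C\<^sub>2 * pb / 64 \<le> real t * (\<Sum>j\<in>{1..p}. (a j)\<^sup>2) / real G"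
      using G by (simp add: le_divide_eq)
    then show ?thesis using equal_groupingD(2)[OF B t] g by (simp add: G_def)
  qed
  define S where "S = {E \<in> space P. card {1..G} \<le>
    2 * card {g \<in> {1..G}. drift_stat p n (B t g) a E \<in> {..c}}}"
  have St: "S \<in> events \<and> prob S \<le> 2 * sqrt q"
  proof -
    have J: "finite {1..G}" "{1..G} \<noteq> {}" using G by auto
    have ind: "indep_vars (\<lambda>_. borel) (\<lambda>g. drift_stat p n (B t g) a) {1..G}"
      using G unfolding G_def
      by (intro indep_vars_drift_stat[OF P \<alpha> K sub(1)[unfolded G_def]] equal_groupingD(3)[OF B t, of 1]) auto
    have bd: "prob {E \<in> space P. drift_stat p n (B t g) a E \<in> {..c}} \<le> q"
      if g: "g \<in> {1..G}" for g
    proof -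
      let ?H = "real (card (B t g)) * (\<Sum>j\<in>{1..p}. (a j)\<^sup>2)"
      \<comment> \<open>768 is 64 * 4 * 3, with the 4 from the requirement
        \<open>H \<ge> 4 * c\<close> of \<open>drift_stat_lower_tail\<close> and the 3 from
        \<open>c = 3 * L * pb\<close>. Likewise the 1024 in the hypothesis on \<open>q\<close> is 16
        * 64.\<close>
      have "768 * L * pb \<le> C\<^sub>2 * pb" using C2 pb by (intro mult_right_mono) auto
      then have H4: "4 * c \<le> ?H" using H[OF g] by (simp add: c_def)
      have "C\<^sub>2 * 1 \<le> C\<^sub>2 * pb" using C2p pb by (intro mult_left_mono) auto
      then have "C\<^sub>2 / 64 \<le> ?H" using H[OF g] by simp
      then have "16 / ?H \<le> 16 / (C\<^sub>2 / 64)" using C2p by (intro divide_left_mono) auto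
      then show ?thesis
        using drift_stat_lower_tail[OF P \<alpha> K p sub[OF g] L, of a] H4 q(1) by (simp add: c_def pb_def)
    qed
    have A: "{..c} \<in> sets borel" by simp
    note majority = indep_vars_majority[where A = "{..c}", OF J ind A q(2) q1 bd]
    have "prob S \<le> (2 * sqrt q) ^ card {1..G}"
      unfolding S_def by (rule majority(2))
    moreover have "S \<in> events"
      unfolding S_def by (rule majority(1))
    \<comment> \<open>There may be a single group, as at \<open>t = 1\<close>, so only the first
      power is kept.\<close>
    moreover have "(2 * sqrt q) ^ card {1..G} \<le> (2 * sqrt q) ^ 1"
      using q G by (intro power_decreasing) auto
    ultimately show ?thesis by simp
  qed
  show ?thesis
  proof (rule nn_integral_law_le[OF P _ conjunct1[OF St] conjunct2[OF St]])
    show "(\<lambda>X. 1 - dense_test \<alpha> (3 * L) p n B X) \<in> borel_measurable (mat_borel p n)"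
      using measurable_dense_test[OF n B] by simp
  next
    fix E assume E: "E \<in> space P"
    let ?X = "\<lambda>i\<in>mat_ix p n. \<theta> i + E i"
    show "1 - dense_test \<alpha> (3 * L) p n B ?X \<le> indicator S E"
    proof (cases "A_MoM p n B ?X t / (c * real (num_groups n t)) > 1")
      case True
      then show ?thesis using t by (auto simp: dense_test_eq_of_bool[OF n] thr)
    next
      case False
      have "group_stat p n (B t g) ?X = drift_stat p n (B t g) a E" if g: "g \<in> {1..G}" for g
      proof (rule group_stat_eq_drift_stat[OF sub(1)[OF g]])
        fix i j assume ij: "i \<in> B t g" "j \<in> {1..p}"
        then have "i \<in> {1..t}" using equal_groupingD(1)[OF B t] g unfolding G_def by blast
        then show "(\<theta> (j, i) - \<theta> (j, n - i + 1)) / sqrt 2 = a j" using a ij by simp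
      qed
      then have "{g \<in> {1..G}. group_stat p n (B t g) ?X \<in> {..c}} =
          {g \<in> {1..G}. drift_stat p n (B t g) a E \<in> {..c}}" by auto
      then have "E \<in> S"
        using A_MoM_threshold_imp_majority(2)[OF n B t c False] E by (simp add: S_def G_def)
      then show ?thesis by (simp add: dense_test_def)
    qed
  qed
qed

section \<open>Choice of the constants\<close>

theorem theorem4:
  fixes \<alpha> K \<epsilon> :: real
  assumes "\<alpha> \<ge> 2" and "K > 0" and "0 < \<epsilon>" and "\<epsilon> < 1"
  shows "\<exists>C\<^sub>1 > 0. \<exists>C\<^sub>2 > 0. \<forall>n \<ge> 2. \<forall>p \<ge> 1. \<forall>s \<in> {1..p}. \<forall>B. equal_grouping n B \<longrightarrow>
    (\<forall>\<rho>::real. \<rho>\<^sup>2 \<ge> C\<^sub>2 * real p powr (max (2/\<alpha>) (1/2)) * ln (ln (8 * real n)) \<longrightarrow>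
      risk \<alpha> K p n s \<rho> (dense_test \<alpha> C\<^sub>1 p n B) \<le> ennreal \<epsilon>)"
proof -
  \<comment> \<open>Chosen so that the null error \<open>4 * (2 * sqrt q)\<close> equals
    \<open>\<epsilon> / 2\<close>; the alternative error \<open>2 * sqrt q\<close> is then
    \<open>\<epsilon> / 8\<close>.\<close>
  define q where "q = (\<epsilon> / 16)\<^sup>2"
  define M where "M = noise_moment_bound \<alpha> K"
  \<comment> \<open>\<open>L\<close> makes the noise tail \<open>(2 * M + 4) / L\<close> equal to
    \<open>q / 2\<close>. The summand \<open>2048 / q\<close> of \<open>C\<^sub>2\<close> leaves at
    most \<open>q / 2\<close> for \<open>1024 / C\<^sub>2\<close>, and its summand
    \<open>768 * L\<close> ensures that the drift dominates.\<close>
  define L where "L = (4 * M + 8) / q"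
  define C\<^sub>2 where "C\<^sub>2 = 768 * L + 2048 / q"
  have q: "0 < q" "q \<le> 1" "2 * sqrt q = \<epsilon> / 8"
    using assms by (simp_all add: q_def power_le_one)
  have M: "M \<ge> 2" by (simp add: M_def noise_moment_bound_def)
  have L: "L \<ge> 4 * M + 8"
    using q M divide_left_mono[of q 1 "4 * M + 8"] by (simp add: L_def)
  have L1: "1 \<le> L" "noise_moment_bound \<alpha> K \<le> L" using L M by (simp_all add: M_def)
  have tail: "(2 * noise_moment_bound \<alpha> K + 4) / L = q / 2"
    using q M by (simp add: L_def M_def[symmetric] field_simps)
  have C2: "C\<^sub>2 \<ge> 768 * L" "C\<^sub>2 > 0" using q L1 by (simp_all add: C\<^sub>2_def add_pos_pos)
  have "1024 / C\<^sub>2 \<le> 1024 / (2048 / q)"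
    using q L1 C2 by (intro divide_left_mono) (auto simp: C\<^sub>2_def)
  then have tail2: "(2 * noise_moment_bound \<alpha> K + 4) / L + 1024 / C\<^sub>2 \<le> q" unfolding tail by simp
  show ?thesis
  proof (rule exI[of _ "3 * L"], rule conjI, use L1 in simp, rule exI[of _ C\<^sub>2],
      rule conjI, rule C2(2), intro allI impI ballI)
    fix n p s :: nat and B and \<rho> :: real
    assume n: "2 \<le> n" and p: "1 \<le> p" and B: "equal_grouping n B"
      and \<rho>: "C\<^sub>2 * real p powr (max (2/\<alpha>) (1/2)) * ln (ln (8 * real n)) \<le> \<rho>\<^sup>2"
    have "(\<integral>\<^sup>+X. ennreal (dense_test \<alpha> (3 * L) p n B X) \<partial>law p n \<theta> P) \<le> ennreal (\<epsilon> / 2)"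
      if "P \<in> joint_noise_class \<alpha> K p n" "\<theta> \<in> null_space p n" for P \<theta>
      using dense_test_null_error[OF that(1) assms(1,2) p n B that(2) L1, of q] tail q assms by simp
    moreover
    have "(\<integral>\<^sup>+X. ennreal (1 - dense_test \<alpha> (3 * L) p n B X) \<partial>law p n \<theta> P) \<le> ennreal (\<epsilon> / 2)"
      if "P \<in> joint_noise_class \<alpha> K p n" "\<theta> \<in> alt_space p n s \<rho>" for P \<theta>
    proof -
      have "(\<integral>\<^sup>+X. ennreal (1 - dense_test \<alpha> (3 * L) p n B X) \<partial>law p n \<theta> P) \<le> ennreal (2 * sqrt q)"
        using \<rho> tail2 q assms
        by (intro dense_test_alt_error[OF that(1) assms(1,2) p n B that(2) L1 C2(1)])
          (simp_all add: max.commute)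
      also have "\<dots> \<le> ennreal (\<epsilon> / 2)" using q assms by (intro ennreal_leI) simp
      finally show ?thesis .
    qed
    \<comment> \<open>Each supremum is at most \<open>\<epsilon> / 2\<close>;
      \<open>SUP_least\<close> also covers an empty noise class, where it is 0.\<close>
    ultimately have "risk \<alpha> K p n s \<rho> (dense_test \<alpha> (3 * L) p n B) \<le> ennreal (\<epsilon> / 2) + ennreal (\<epsilon> / 2)"
      unfolding risk_def by (intro add_mono SUP_least)
    also have "\<dots> = ennreal \<epsilon>" using assms by (simp flip: ennreal_plus)
    finally show "risk \<alpha> K p n s \<rho> (dense_test \<alpha> (3 * L) p n B) \<le> ennreal \<epsilon>" .
  qed
qed

end
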